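(* Let $\Omega\subset\mathbb{R}^n$ be a bounded domain, let $p\ge 2$ and $2n<\alpha p<n+p$, and put $s=\alpha-n/p$. If $u\in W_0^{s,p}(\Omega)$ is a non-negative eigenfunction of $\Omega$ (with some eigenvalue $\lambda$), then $u$ minimizes the Rayleigh quotient, i.e. $$\frac{\int_{\mathbb{R}^n}\int_{\mathbb{R}^n}\frac{|u(y)-u(x)|^p}{|y-x|^{\alpha p}}\,dx\,dy}{\int_{\mathbb{R}^n}|u(x)|^p\,dx}=\lambda_1 .$$
   Context: $W^{s,p}_0(\Omega)$ is the closure of $C_0^\infty(\Omega)$ in the fractional Sobolev norm of $W^{s,p}(\Omega)$, given by $\|u\|^p=\iint \frac{|u(y)-u(x)|^p}{|y-x|^{n+sp}}\,dx\,dy+\int|u|^p\,dx$; note $n+sp=\alpha p$. Functions in $W^{s,p}_0(\Omega)$ are extended by zero to $\mathbb{R}^n$. The number $\lambda_1$ is the infimum over all $\phi\in C_0^\infty(\Omega)$, $\phi\not\equiv0$, of the quotient $\int_{\mathbb{R}^n}\int_{\mathbb{R}^n}\frac{|\phi(y)-\phi(x)|^p}{|y-x|^{\alpha p}}\,dx\,dy\big/\int_{\mathbb{R}^n}|\phi|^p\,dx$. A function $u\in W^{s,p}_0(\Omega)$, $u\not\equiv0$, is an eigenfunction of $\Omega$ with eigenvalue $\lambda$ if $$\int_{\mathbb{R}^n}\int_{\mathbb{R}^n}\frac{|u(y)-u(x)|^{p-2}(u(y)-u(x))(\phi(y)-\phi(x))}{|y-x|^{\alpha p}}\,dx\,dy=\lambda\int_{\mathbb{R}^n}|u|^{p-2}u\,\phi\,dx$$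 for all $\phi\in C_0^\infty(\Omega)$. *)

theory Defs
  imports "HOL-Analysis.Analysis"
begin

fun times_cont_diff :: "nat \<Rightarrow> ('a::euclidean_space \<Rightarrow> real) \<Rightarrow> bool" where
  "times_cont_diff 0 f \<longleftrightarrow> continuous_on UNIV f"
| "times_cont_diff (Suc k) f \<longleftrightarrow>
     (\<forall>x. f differentiable (at x)) \<and>
     (\<forall>v. times_cont_diff k (\<lambda>x. frechet_derivative f (at x) v))"

text \<open>\<open>C\<^sub>0\<^sup>\<infinity>(\<Omega>)\<close>: smooth functions with compact support contained in \<open>\<Omega>\<close>,
  regarded as functions on the whole space.\<close>

definition test_functions :: "'a::euclidean_space set \<Rightarrow> ('a \<Rightarrow> real) set" where
  "test_functions \<Omega> = {\<phi>. (\<forall>k. times_cont_diff k \<phi>) \<and>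
     compact (closure {x. \<phi> x \<noteq> 0}) \<and> closure {x. \<phi> x \<noteq> 0} \<subseteq> \<Omega>}"

text \<open>The double integral of \<open>\<bar>u(y) - u(x)\<bar>\<^sup>p / \<bar>y - x\<bar>\<^sup>q\<close> over \<open>A \<times> A\<close>, with values in
  \<open>[0, \<infinity>]\<close>. The value of the integrand on the diagonal is irrelevant, since the diagonal is a
  null set.\<close>

definition gagliardo_energy ::
    "'a::euclidean_space set \<Rightarrow> real \<Rightarrow> real \<Rightarrow> ('a \<Rightarrow> real) \<Rightarrow> ennreal" where
  "gagliardo_energy A q p u =
     (\<integral>\<^sup>+(x, y)\<in>A \<times> A. ennreal (\<bar>u y - u x\<bar> powr p / norm (y - x) powr q)
        \<partial>(lborel \<Otimes>\<^sub>M lborel))"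

definition Lp_energy :: "'a::euclidean_space set \<Rightarrow> real \<Rightarrow> ('a \<Rightarrow> real) \<Rightarrow> ennreal" where
  "Lp_energy A p u = (\<integral>\<^sup>+x\<in>A. ennreal (\<bar>u x\<bar> powr p) \<partial>lborel)"

text \<open>The \<open>p\<close>-th power of the norm of \<open>W\<^sup>s\<^sup>,\<^sup>p(\<Omega>)\<close>.\<close>

definition frac_norm_pow ::
    "real \<Rightarrow> real \<Rightarrow> 'a::euclidean_space set \<Rightarrow> ('a \<Rightarrow> real) \<Rightarrow> ennreal" where
  "frac_norm_pow s p \<Omega> u =
     gagliardo_energy \<Omega> (real DIM('a) + s * p) p u + Lp_energy \<Omega> p u"

text \<open>\<open>W\<^sub>0\<^sup>s\<^sup>,\<^sup>p(\<Omega>)\<close>. An element is given by a Borel representative of its equivalence class modulo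
  null sets, extended by zero to the whole space. Closeness in the \<open>p\<close>-th power of the norm is
  the same as closeness in the norm.\<close>

definition frac_sobolev0 ::
    "real \<Rightarrow> real \<Rightarrow> 'a::euclidean_space set \<Rightarrow> ('a \<Rightarrow> real) set" where
  "frac_sobolev0 s p \<Omega> = {u \<in> borel_measurable borel.
     frac_norm_pow s p \<Omega> u < \<infinity> \<and>
     (\<forall>x. x \<notin> \<Omega> \<longrightarrow> u x = 0) \<and>
     (\<forall>\<epsilon>>0. \<exists>\<phi>\<in>test_functions \<Omega>. frac_norm_pow s p \<Omega> (\<lambda>x. \<phi> x - u x) < \<epsilon>)}"

definition rayleigh_quotient ::
    "real \<Rightarrow> real \<Rightarrow> ('a::euclidean_space \<Rightarrow> real) \<Rightarrow> ennreal" where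
  "rayleigh_quotient \<alpha> p u = gagliardo_energy UNIV (\<alpha> * p) p u / Lp_energy UNIV p u"

definition lambda1 :: "real \<Rightarrow> real \<Rightarrow> 'a::euclidean_space set \<Rightarrow> ennreal" where
  "lambda1 \<alpha> p \<Omega> = (INF \<phi>\<in>test_functions \<Omega> - {\<lambda>x. 0}. rayleigh_quotient \<alpha> p \<phi>)"

text \<open>The condition \<open>u \<noteq> 0\<close> has to be read modulo null sets. For \<open>p = 2\<close> the convention
  \<open>0 powr 0 = 0\<close> is harmless, since the factor next to the power vanishes as well.\<close>

definition eigenfunction ::
    "real \<Rightarrow> real \<Rightarrow> 'a::euclidean_space set \<Rightarrow> real \<Rightarrow> ('a \<Rightarrow> real) \<Rightarrow> bool" where
  "eigenfunction \<alpha> p \<Omega> \<mu> u \<longleftrightarrow>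
     u \<in> frac_sobolev0 (\<alpha> - real DIM('a) / p) p \<Omega> \<and>
     \<not> (AE x in lborel. u x = 0) \<and>
     (\<forall>\<phi>\<in>test_functions \<Omega>.
        (\<integral>(x, y). \<bar>u y - u x\<bar> powr (p - 2) * (u y - u x) * (\<phi> y - \<phi> x)
            / norm (y - x) powr (\<alpha> * p) \<partial>(lborel \<Otimes>\<^sub>M lborel))
        = \<mu> * (\<integral>x. \<bar>u x\<bar> powr (p - 2) * u x * \<phi> x \<partial>lborel))"

end

theory Submission
  imports Defs
begin

text \<open>Let \<open>q = \<alpha> p\<close>. Testing the equation with the Picone quotient
  \<open>\<bar>\<phi>\<bar>\<^sup>p (u + \<epsilon>)\<^sup>1\<^sup>-\<^sup>p\<close> and using the discrete Picone inequality bounds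
  \<open>\<mu> \<integral> \<bar>\<phi>\<bar>\<^sup>p (u / (u + \<epsilon>))\<^sup>p\<^sup>-\<^sup>1\<close> by the energy of \<open>\<phi>\<close>. The defect of
  the inequality stays bounded in \<open>L\<^sup>1\<close> but tends to infinity where \<open>\<phi> x \<noteq> 0\<close>
  and \<open>u x = 0 < u y\<close>, so \<open>u > 0\<close> almost everywhere on the support of \<open>\<phi>\<close>, and
  \<open>\<epsilon> \<rightarrow> 0\<close> gives \<open>\<mu> \<le> \<lambda>\<^sub>1\<close>. Conversely, testing with truncations of \<open>u\<close> and
  Fatou's lemma show that the energy of \<open>u\<close> over the whole space is at most \<open>\<mu> \<integral> u\<^sup>p\<close>;
  being finite, it is the limit of energies of test functions, hence at least
  \<open>\<lambda>\<^sub>1 \<integral> u\<^sup>p\<close>. No mollification is needed: the approximants are smooth nonlinear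
  functions of the test functions that approximate \<open>u\<close>, and a fast subsequence provides
  the dominating functions.\<close>

subsection \<open>Smooth functions\<close>

text \<open>The obstacle is the boundary of \<open>\<Omega>\<close>. The Sobolev norm sees only
  pairs in \<open>\<Omega> \<times> \<Omega>\<close>, while the equation and \<open>lambda1\<close>
  integrate over all pairs. Since \<open>q = \<alpha> * p\<close> exceeds the dimension, the
  integral of the kernel over the complement of \<open>\<Omega>\<close> is bounded for points of a
  compact subset but may be unbounded near the boundary, so closeness in the Sobolev norm says
  nothing about mixed pairs. For the Picone quotient the support is that of the fixed
  \<open>\<phi>\<close>, and a constant depending on this support controls the mixed pairs. For
  approximations of \<open>u\<close> the supports grow. There the sign helps: on mixed pairs the
  weak integrand of a nonnegative test function is nonnegative, so Fatou's lemma needs a minorant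
  only on \<open>\<Omega> \<times> \<Omega>\<close>. That the energy of \<open>u\<close> over the
  whole space is finite is thus a consequence of the equation, and only this makes the energies of
  the approximants converge.\<close>

lemma times_cont_diff_SucD: "times_cont_diff (Suc k) f \<Longrightarrow> times_cont_diff k f"
proof (induction k arbitrary: f)
  case 0
  then show ?case
    by (auto intro!: differentiable_imp_continuous_on simp: differentiable_on_def
        intro: differentiable_at_withinI)
next
  case (Suc k)
  then show ?case by simp
qed

lemma times_cont_diff_const: "times_cont_diff k (\<lambda>x. c)"
  by (induction k arbitrary: c) (simp_all add: frechet_derivative_const)

lemma times_cont_diff_add:
  "times_cont_diff k f \<Longrightarrow> times_cont_diff k g \<Longrightarrow> times_cont_diff k (\<lambda>x. f x + g x)"
proof (induction k arbitrary: f g)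
  case 0
  then show ?case by (simp add: continuous_on_add)
next
  case (Suc k)
  have "frechet_derivative (\<lambda>x. f x + g x) (at x) v
      = frechet_derivative f (at x) v + frechet_derivative g (at x) v" for x v
  proof -
    have "((\<lambda>x. f x + g x) has_derivative
        (\<lambda>v. frechet_derivative f (at x) v + frechet_derivative g (at x) v)) (at x)"
      using Suc.prems by (intro has_derivative_add) (simp_all flip: frechet_derivative_works)
    from frechet_derivative_at[OF this] show ?thesis by (rule fun_cong[where x = v, symmetric])
  qed
  with Suc show ?case by simp
qed

lemma times_cont_diff_mult:
  "times_cont_diff k f \<Longrightarrow> times_cont_diff k g \<Longrightarrow> times_cont_diff k (\<lambda>x. f x * g x)"
proof (induction k arbitrary: f g)
  case 0
  then show ?case by (simp add: continuous_on_mult)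
next
  case (Suc k)
  have eq: "frechet_derivative (\<lambda>x. f x * g x) (at x) v
      = f x * frechet_derivative g (at x) v + frechet_derivative f (at x) v * g x" for x v
  proof -
    have "((\<lambda>x. f x * g x) has_derivative
        (\<lambda>v. f x * frechet_derivative g (at x) v + frechet_derivative f (at x) v * g x)) (at x)"
      using Suc.prems by (intro has_derivative_mult) (simp_all flip: frechet_derivative_works)
    from frechet_derivative_at[OF this] show ?thesis by (rule fun_cong[where x = v, symmetric])
  qed
  have "times_cont_diff k (\<lambda>x. f x * frechet_derivative g (at x) v
      + frechet_derivative f (at x) v * g x)" for v
    using Suc.prems Suc.IH times_cont_diff_SucD[of k f] times_cont_diff_SucD[of k g]
    by (intro times_cont_diff_add) auto
  with eq Suc.prems show ?case by simp
qed

text \<open>The derivative contains a power of the same positive \<open>f\<close> with exponent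
  \<open>r - 1\<close>, hence the induction over arbitrary \<open>r\<close>. Square roots
  (\<open>r = 1 / 2\<close>) and reciprocals (\<open>r = - 1\<close>) are obtained from this lemma
  too.\<close>

lemma times_cont_diff_powr:
  "times_cont_diff k f \<Longrightarrow> (\<And>x. f x > 0) \<Longrightarrow> times_cont_diff k (\<lambda>x. f x powr r)"
proof (induction k arbitrary: f r)
  case 0
  then show ?case by (auto intro!: continuous_on_powr simp: less_imp_neq[symmetric])
next
  case (Suc k)
  have D: "((\<lambda>x. f x powr r) has_derivative
        (\<lambda>v. r * (f x powr (r - 1) * frechet_derivative f (at x) v))) (at x)" for x
  proof -
    have "(f has_derivative frechet_derivative f (at x)) (at x)"
      using Suc.prems by (simp flip: frechet_derivative_works)
    from has_derivative_powr[OF this has_derivative_const[of r] Suc.prems(2)]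
    show ?thesis using Suc.prems(2)[of x]
      by (simp add: powr_diff field_simps)
  qed
  then have eq: "frechet_derivative (\<lambda>x. f x powr r) (at x) v
      = r * (f x powr (r - 1) * frechet_derivative f (at x) v)" for x v
    using frechet_derivative_at[OF D] by metis
  have "times_cont_diff k (\<lambda>x. r * (f x powr (r - 1) * frechet_derivative f (at x) v))" for v
    using Suc.prems Suc.IH times_cont_diff_SucD[of k f]
    by (intro times_cont_diff_mult times_cont_diff_const) auto
  with eq D show ?case by (auto simp: differentiable_def)
qed

text \<open>For nonlinear expressions in a test function, compactness of the support is inherited: a
  function that vanishes wherever \<open>\<phi>\<close> does has a smaller support.\<close>

lemma test_functionsI:
  assumes "\<phi> \<in> test_functions \<Omega>" and "\<And>k. times_cont_diff k f"
    and "\<And>x. \<phi> x = 0 \<Longrightarrow> f x = 0"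
  shows "f \<in> test_functions \<Omega>"
proof -
  have sub: "closure {x. f x \<noteq> 0} \<subseteq> closure {x. \<phi> x \<noteq> 0}"
    using assms(3) by (intro closure_mono) auto
  moreover have "compact (closure {x. \<phi> x \<noteq> 0})" "closure {x. \<phi> x \<noteq> 0} \<subseteq> \<Omega>"
    using assms(1) by (auto simp: test_functions_def)
  moreover have "compact (closure {x. f x \<noteq> 0})"
    by (metis calculation(1,2) closed_closure compact_Int_closed inf.absorb_iff2)
  ultimately show ?thesis using assms(2) by (auto simp: test_functions_def)
qed

lemma test_functions_times_cont_diff: "\<phi> \<in> test_functions \<Omega> \<Longrightarrow> times_cont_diff k \<phi>"
  by (simp add: test_functions_def)

lemma test_functions_continuous: "\<phi> \<in> test_functions \<Omega> \<Longrightarrow> continuous_on UNIV \<phi>"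
  using test_functions_times_cont_diff[of \<phi> \<Omega> 0] by simp

lemma test_functions_measurable: "\<phi> \<in> test_functions \<Omega> \<Longrightarrow> \<phi> \<in> borel_measurable borel"
  by (intro borel_measurable_continuous_onI test_functions_continuous)

lemma test_functions_outside: "\<phi> \<in> test_functions \<Omega> \<Longrightarrow> x \<notin> \<Omega> \<Longrightarrow> \<phi> x = 0"
  using closure_subset[of "{x. \<phi> x \<noteq> 0}"] by (auto simp: test_functions_def)

lemma test_functions_bounded:
  assumes "\<phi> \<in> test_functions \<Omega>"
  obtains C where "C \<ge> 0" and "\<And>x. \<bar>\<phi> x\<bar> \<le> C"
proof -
  let ?K = "closure {x. \<phi> x \<noteq> 0}"
  have "compact (\<phi> ` ?K)"
    using assms test_functions_continuous[OF assms]
    by (intro compact_continuous_image) (auto simp: test_functions_def intro: continuous_on_subset)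
  then obtain C where C: "\<And>x. x \<in> ?K \<Longrightarrow> \<bar>\<phi> x\<bar> \<le> C"
    using compact_imp_bounded bounded_iff by (metis imageI real_norm_def)
  have "\<bar>\<phi> x\<bar> \<le> max 0 C" for x
    using C[of x] closure_subset[of "{x. \<phi> x \<noteq> 0}"] by (cases "\<phi> x = 0") auto
  with that[of "max 0 C"] show ?thesis by simp
qed

subsection \<open>Pointwise inequalities\<close>

lemma powr_add_le:
  fixes a b p :: real
  assumes "0 \<le> a" "0 \<le> b" "0 \<le> p"
  shows "(a + b) powr p \<le> 2 powr p * (a powr p + b powr p)"
proof -
  have "(a + b) powr p \<le> (2 * max a b) powr p"
    using assms by (intro powr_mono2) auto
  also have "\<dots> = 2 powr p * (max a b) powr p"
    using assms by (simp add: powr_mult)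
  also have "\<dots> \<le> 2 powr p * (a powr p + b powr p)"
    by (intro mult_left_mono) (auto simp: max_def)
  finally show ?thesis .
qed

text \<open>A crude Young inequality: whichever of \<open>a\<close> and \<open>b\<close> is larger
  bounds both factors.\<close>

lemma powr_young_le:
  fixes a b p :: real
  assumes "0 \<le> a" "0 \<le> b" "1 \<le> p"
  shows "a powr (p - 1) * b \<le> a powr p + b powr p"
proof (cases "a \<le> b")
  case True
  have "a powr (p - 1) * b \<le> b powr (p - 1) * b"
    using assms True by (intro mult_right_mono powr_mono2) auto
  also have "\<dots> = b powr p"
    using assms by (cases "b = 0") (simp_all add: powr_diff)
  finally show ?thesis by (simp add: add_increasing)
next
  case False
  then have "a powr (p - 1) * b \<le> a powr (p - 1) * a"
    by (intro mult_left_mono) auto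
  also have "\<dots> = a powr p"
    using assms False by (simp add: powr_diff)
  finally show ?thesis by (simp add: add_increasing2)
qed

lemma abs_powr_mult_self:
  fixes t p :: real
  shows "0 \<le> t \<Longrightarrow> \<bar>t\<bar> powr (p - 2) * t = t powr (p - 1)"
  by (cases "t = 0") (simp_all add: powr_diff power2_eq_square)

lemma abs_abs_powr_mult_self:
  fixes t p :: real
  shows "\<bar>\<bar>t\<bar> powr (p - 2) * t\<bar> = \<bar>t\<bar> powr (p - 1)"
  using abs_powr_mult_self[of "\<bar>t\<bar>" p] by (simp add: abs_mult)

lemma powr_convex_combination:
  fixes x y \<theta> p :: real
  assumes "0 \<le> x" "0 \<le> y" "0 < \<theta>" "\<theta> < 1" "1 \<le> p"
  shows "((1 - \<theta>) * x + \<theta> * y) powr p \<le> (1 - \<theta>) * x powr p + \<theta> * y powr p"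
proof -
  \<comment> \<open>If one of the two points is zero, the claim reduces to this inequality for the
    weight of the other point.\<close>
  have le: "c powr p \<le> c" if "0 < c" "c < 1" for c :: real
    using powr_mono'[of 1 p c] that assms by simp
  consider "x = 0" | "y = 0" | "0 < x" "0 < y" using assms by linarith
  then show ?thesis
  proof cases
    case 1
    then show ?thesis using le[of \<theta>] assms by (simp add: powr_mult mult_right_mono)
  next
    case 2
    then show ?thesis using le[of "1 - \<theta>"] assms by (simp add: powr_mult mult_right_mono)
  next
    case 3
    then show ?thesis
      using convex_onD[OF powr_convex[OF assms(5)], of \<theta> x y] assms by simp
  qed
qed

text \<open>If \<open>A < B\<close>, the bracket is nonpositive because \<open>1 - p\<close> is
  negative and \<open>t \<le> s\<close>. Otherwise the left side is homogeneous of degree 0 in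
  \<open>(s, t)\<close>, so only the ratio \<open>t / s\<close> matters, and the claim is convexity
  of the \<open>p\<close>-th power.\<close>

lemma picone_ordered:
  fixes s t A B p :: real
  assumes "0 < t" "t \<le> s" "0 \<le> A" "0 \<le> B" "2 \<le> p"
  shows "(s - t) powr (p - 1) * (A powr p * s powr (1 - p) - B powr p * t powr (1 - p))
    \<le> \<bar>A - B\<bar> powr p"
proof (cases "t = s \<or> A < B")
  case True
  then show ?thesis
  proof
    assume "A < B"
    have "A powr p * s powr (1 - p) \<le> B powr p * t powr (1 - p)"
      using assms \<open>A < B\<close> by (intro mult_mono powr_mono2 powr_mono2') auto
    then have "(s - t) powr (p - 1) * (A powr p * s powr (1 - p) - B powr p * t powr (1 - p)) \<le> 0"
      by (intro mult_nonneg_nonpos) auto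
    then show ?thesis by (smt (verit) powr_ge_zero)
  qed simp
next
  case False
  define \<theta> where "\<theta> = t / s"
  have \<theta>: "0 < \<theta>" "\<theta> < 1" and s: "0 < s" and AB: "B \<le> A"
    using False assms by (auto simp: \<theta>_def)
  have t: "t = \<theta> * s" using s by (simp add: \<theta>_def)
  \<comment> \<open>The weights are chosen so that the convex combination of
    \<open>(A - B) / (1 - \<theta>)\<close> and \<open>B / \<theta>\<close> is exactly
    \<open>A\<close>.\<close>
  have "A powr p = ((1 - \<theta>) * ((A - B) / (1 - \<theta>)) + \<theta> * (B / \<theta>)) powr p"
    using \<theta> by simp
  also have "\<dots> \<le> (1 - \<theta>) * ((A - B) / (1 - \<theta>)) powr p + \<theta> * (B / \<theta>) powr p"
    using \<theta> assms AB by (intro powr_convex_combination) auto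
  also have "\<dots> = (1 - \<theta>) powr (1 - p) * (A - B) powr p + \<theta> powr (1 - p) * B powr p"
    using \<theta> assms AB by (simp add: powr_divide powr_diff)
  finally have "A powr p - \<theta> powr (1 - p) * B powr p \<le> (1 - \<theta>) powr (1 - p) * (A - B) powr p"
    by simp
  then have "(1 - \<theta>) powr (p - 1) * (A powr p - \<theta> powr (1 - p) * B powr p)
      \<le> (1 - \<theta>) powr (p - 1) * ((1 - \<theta>) powr (1 - p) * (A - B) powr p)"
    by (intro mult_left_mono) auto
  also have "\<dots> = (A - B) powr p"
    using \<theta> by (simp add: mult.assoc[symmetric] powr_add[symmetric])
  finally have main: "(1 - \<theta>) powr (p - 1) * (A powr p - \<theta> powr (1 - p) * B powr p)
      \<le> (A - B) powr p" .
  have "(s - t) powr (p - 1) = s powr (p - 1) * (1 - \<theta>) powr (p - 1)"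
    using \<theta> s by (simp add: t powr_mult[symmetric] algebra_simps)
  moreover have "t powr (1 - p) = \<theta> powr (1 - p) * s powr (1 - p)"
    using \<theta> s by (simp add: t powr_mult)
  ultimately have "(s - t) powr (p - 1) * (A powr p * s powr (1 - p) - B powr p * t powr (1 - p))
      = (s powr (p - 1) * s powr (1 - p)) *
        ((1 - \<theta>) powr (p - 1) * (A powr p - \<theta> powr (1 - p) * B powr p))"
    by (simp add: right_diff_distrib mult_ac)
  with main AB s show ?thesis by (simp add: powr_add[symmetric])
qed

text \<open>Exchanging \<open>(s, A)\<close> with \<open>(t, B)\<close> flips two signs on the left,
  which cancel, so the ordered case suffices.\<close>

lemma discrete_picone:
  fixes s t A B p :: real
  assumes "0 < s" "0 < t" "0 \<le> A" "0 \<le> B" "2 \<le> p"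
  shows "\<bar>s - t\<bar> powr (p - 2) * (s - t) * (A powr p * s powr (1 - p) - B powr p * t powr (1 - p))
    \<le> \<bar>A - B\<bar> powr p"
proof (cases "t \<le> s")
  case True
  then show ?thesis
    using picone_ordered[of t s A B p] abs_powr_mult_self[of "s - t" p] assms by simp
next
  case False
  then have eq: "\<bar>s - t\<bar> powr (p - 2) * (s - t) = - ((t - s) powr (p - 1))"
    using abs_powr_mult_self[of "t - s" p] by (simp add: abs_minus_commute algebra_simps)
  then show ?thesis
    using picone_ordered[of s t B A p] assms False
    unfolding eq by (simp add: abs_minus_commute algebra_simps)
qed

lemma powr_lipschitz:
  fixes r M x y :: real
  assumes "0 < m" "m \<le> x" "x \<le> M" "m \<le> y" "y \<le> M"
    and C: "\<And>z. m \<le> z \<Longrightarrow> z \<le> M \<Longrightarrow> \<bar>r * z powr (r - 1)\<bar> \<le> C"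
  shows "\<bar>x powr r - y powr r\<bar> \<le> C * \<bar>x - y\<bar>"
proof -
  have "norm (x powr r - y powr r) \<le> C * norm (x - y)"
  proof (rule field_differentiable_bound[of "{m..M}"])
    show "((\<lambda>z. z powr r) has_field_derivative r * z powr (r - 1)) (at z within {m..M})"
      if "z \<in> {m..M}" for z
      using that assms by (intro has_field_derivative_at_within[OF has_real_derivative_powr]) auto
  qed (use assms in auto)
  then show ?thesis by simp
qed

text \<open>The smooth functions \<open>t \<mapsto> \<surd>(t\<^sup>2 + d\<^sup>2)\<close> replace the absolute value, so that nonlinear
  expressions in test functions remain test functions.\<close>

definition smooth_abs :: "real \<Rightarrow> real \<Rightarrow> real" where
  "smooth_abs d t = (t * t + d * d) powr (1 / 2)"

lemma smooth_abs_sqrt: "smooth_abs d t = sqrt (t\<^sup>2 + d\<^sup>2)"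
  by (simp add: smooth_abs_def powr_half_sqrt power2_eq_square)

lemma smooth_abs_ge: "\<bar>t\<bar> \<le> smooth_abs d t" "d \<le> smooth_abs d t"
  unfolding smooth_abs_sqrt by (rule real_le_rsqrt; simp)+

lemma smooth_abs_le: "0 \<le> d \<Longrightarrow> smooth_abs d t \<le> \<bar>t\<bar> + d"
  unfolding smooth_abs_sqrt by (intro real_le_lsqrt) (auto simp: power2_eq_square algebra_simps)

lemma smooth_abs_0: "0 \<le> d \<Longrightarrow> smooth_abs d 0 = d"
  by (simp add: smooth_abs_sqrt)

text \<open>\<open>smooth_abs d t\<close> is the modulus of the complex number with real part
  \<open>t\<close> and imaginary part \<open>d\<close>, so this is the reverse triangle inequality.
  The constant does not depend on \<open>d\<close>.\<close>

lemma smooth_abs_lipschitz: "\<bar>smooth_abs d s - smooth_abs d t\<bar> \<le> \<bar>s - t\<bar>"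
  using complex_mod_triangle_ineq2[of "Complex s d" "Complex t d"]
    norm_triangle_ineq3[of "Complex s d" "Complex t d"]
  by (simp add: smooth_abs_sqrt cmod_def)

lemma tendsto_smooth_abs:
  assumes "d \<longlonglongrightarrow> 0" "f \<longlonglongrightarrow> l"
  shows "(\<lambda>j. smooth_abs (d j) (f j)) \<longlonglongrightarrow> \<bar>l\<bar>"
proof -
  have "(\<lambda>j. sqrt ((f j)\<^sup>2 + (d j)\<^sup>2)) \<longlonglongrightarrow> sqrt (l\<^sup>2 + 0\<^sup>2)"
    using assms by (intro tendsto_intros)
  then show ?thesis by (simp add: smooth_abs_sqrt)
qed

lemma times_cont_diff_smooth_abs:
  assumes "times_cont_diff k f" "0 < d"
  shows "times_cont_diff k (\<lambda>x. smooth_abs d (f x))"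
  unfolding smooth_abs_def using assms
  by (intro times_cont_diff_powr times_cont_diff_add times_cont_diff_mult times_cont_diff_const)
    (auto intro: add_nonneg_pos)

lemma times_cont_diff_smooth_abs_powr:
  assumes "times_cont_diff k f" "0 < d" "0 \<le> c"
  shows "times_cont_diff k (\<lambda>x. (smooth_abs d (f x) + c) powr r)"
  using assms smooth_abs_ge(2)[of d]
  by (intro times_cont_diff_powr times_cont_diff_add times_cont_diff_smooth_abs
      times_cont_diff_const) (auto intro: add_pos_nonneg less_le_trans)

subsection \<open>Measure-theoretic tools\<close>

text \<open>The argument of the Riesz-Fischer theorem: the pointwise sum of the errors is
  integrable, hence finite almost everywhere. There it dominates each error, and the errors tend to
  0 as terms of a convergent series.\<close>

lemma summable_dominated:
  fixes e :: "nat \<Rightarrow> 'b \<Rightarrow> real"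
  assumes [measurable]: "\<And>j. e j \<in> borel_measurable M"
    and nonneg: "\<And>j x. 0 \<le> e j x"
    and fin: "(\<Sum>j. \<integral>\<^sup>+x. ennreal (e j x) \<partial>M) < \<infinity>"
  obtains S where "integrable M S" and "\<And>x. 0 \<le> S x"
    and "AE x in M. (\<forall>j. e j x \<le> S x) \<and> (\<lambda>j. e j x) \<longlonglongrightarrow> 0"
proof -
  define T where "T x = (\<Sum>j. ennreal (e j x))" for x
  have [measurable]: "T \<in> borel_measurable M" unfolding T_def by measurable
  have T: "(\<integral>\<^sup>+x. T x \<partial>M) < \<infinity>"
    unfolding T_def using fin by (simp add: nn_integral_suminf)
  then have AE_fin: "AE x in M. T x \<noteq> \<infinity>"
    by (intro nn_integral_PInf_AE) auto
  \<comment> \<open>\<open>enn2real\<close> sends infinity to 0, so the real-valued sum is a valid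
    bound only where \<open>T\<close> is finite.\<close>
  have "(\<integral>\<^sup>+x. ennreal (enn2real (T x)) \<partial>M) \<le> (\<integral>\<^sup>+x. T x \<partial>M)"
    by (intro nn_integral_mono) (simp add: ennreal_enn2real_if)
  then have int: "integrable M (\<lambda>x. enn2real (T x))"
    using T by (intro integrableI_nonneg) (auto intro: le_less_trans)
  have "AE x in M. (\<forall>j. e j x \<le> enn2real (T x)) \<and> (\<lambda>j. e j x) \<longlonglongrightarrow> 0"
    using AE_fin
  proof eventually_elim
    case (elim x)
    have "summable (\<lambda>j. e j x)"
      using elim nonneg by (intro summable_suminf_not_top) (auto simp: T_def)
    moreover from this have "T x = ennreal (\<Sum>j. e j x)"
      unfolding T_def using nonneg by (intro suminf_ennreal_eq summable_sums)
    ultimately show ?case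
      using nonneg sum_le_suminf[of "\<lambda>j. e j x" "{j}" for j]
      by (auto simp: suminf_nonneg dest: summable_LIMSEQ_zero)
  qed
  with that[OF int] show ?thesis by simp
qed

lemma AE_lborel_pair:
  fixes P :: "'a::euclidean_space \<Rightarrow> bool"
  assumes "AE x in lborel. P x"
  shows "AE z in lborel \<Otimes>\<^sub>M (lborel :: 'a measure). P (fst z) \<and> P (snd z)"
proof -
  from assms obtain N where N: "{x. \<not> P x} \<subseteq> N" "N \<in> null_sets lborel"
    by (auto simp: eventually_ae_filter)
  have null: "N \<times> UNIV \<in> null_sets (lborel \<Otimes>\<^sub>M (lborel :: 'a measure))"
    "UNIV \<times> N \<in> null_sets ((lborel :: 'a measure) \<Otimes>\<^sub>M lborel)"
    using N(2) by (auto simp: null_sets_def lborel.emeasure_pair_measure_Times)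
  have "AE z in lborel \<Otimes>\<^sub>M (lborel :: 'a measure). z \<notin> N \<times> UNIV \<union> UNIV \<times> N"
    by (intro AE_not_in null_sets.Un null)
  then show ?thesis
    by eventually_elim (use N(1) in auto)
qed

section \<open>The kernel, energy densities and weak integrands as functions of pairs\<close>

definition kernel :: "real \<Rightarrow> 'a::euclidean_space \<times> 'a \<Rightarrow> real" where
  "kernel q z = 1 / norm (snd z - fst z) powr q"

definition diff_quot :: "real \<Rightarrow> real \<Rightarrow> ('a::euclidean_space \<Rightarrow> real) \<Rightarrow> 'a \<times> 'a \<Rightarrow> real" where
  "diff_quot q p f z = \<bar>f (snd z) - f (fst z)\<bar> powr p * kernel q z"

text \<open>Up to the factor \<open>p\<close>, the derivative of the energy density at
  \<open>u\<close> in the direction \<open>v\<close>.\<close>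

definition weak_integrand ::
    "real \<Rightarrow> real \<Rightarrow> ('a::euclidean_space \<Rightarrow> real) \<Rightarrow> ('a \<Rightarrow> real) \<Rightarrow> 'a \<times> 'a \<Rightarrow> real" where
  "weak_integrand q p u v z = \<bar>u (snd z) - u (fst z)\<bar> powr (p - 2) * (u (snd z) - u (fst z))
     * (v (snd z) - v (fst z)) * kernel q z"

lemma kernel_nonneg: "0 \<le> kernel q z"
  by (simp add: kernel_def)

lemma diff_quot_nonneg: "0 \<le> diff_quot q p f z"
  by (simp add: diff_quot_def kernel_nonneg)

lemma kernel_measurable [measurable]:
  "kernel q \<in> borel_measurable (lborel \<Otimes>\<^sub>M (lborel :: 'a::euclidean_space measure))"
  unfolding kernel_def by measurable

lemma diff_quot_measurable [measurable (raw)]: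
  fixes f :: "'a::euclidean_space \<Rightarrow> real"
  assumes [measurable]: "f \<in> borel_measurable borel"
  shows "diff_quot q p f \<in> borel_measurable (lborel \<Otimes>\<^sub>M lborel)"
  unfolding diff_quot_def by measurable

lemma weak_integrand_measurable [measurable (raw)]:
  fixes u v :: "'a::euclidean_space \<Rightarrow> real"
  assumes [measurable]: "u \<in> borel_measurable borel" "v \<in> borel_measurable borel"
  shows "weak_integrand q p u v \<in> borel_measurable (lborel \<Otimes>\<^sub>M lborel)"
  unfolding weak_integrand_def by measurable

lemma gagliardo_energy_eq:
  "gagliardo_energy A q p u
     = (\<integral>\<^sup>+z. ennreal (diff_quot q p u z) * indicator (A \<times> A) z \<partial>(lborel \<Otimes>\<^sub>M lborel))"
  unfolding gagliardo_energy_def diff_quot_def kernel_def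
  by (intro nn_integral_cong) (simp add: split_beta)

lemma gagliardo_energy_UNIV:
  "gagliardo_energy UNIV q p u = (\<integral>\<^sup>+z. ennreal (diff_quot q p u z) \<partial>(lborel \<Otimes>\<^sub>M lborel))"
  by (simp add: gagliardo_energy_eq)

lemma weak_integrand_eq:
  "(\<lambda>(x, y). \<bar>u y - u x\<bar> powr (p - 2) * (u y - u x) * (v y - v x) / norm (y - x) powr q)
     = weak_integrand q p u v"
  by (auto simp: weak_integrand_def kernel_def)

lemma abs_weak_integrand_le:
  assumes "1 \<le> p"
  shows "\<bar>weak_integrand q p u v z\<bar> \<le> diff_quot q p u z + diff_quot q p v z"
proof -
  have "\<bar>weak_integrand q p u v z\<bar>
      = \<bar>u (snd z) - u (fst z)\<bar> powr (p - 1) * \<bar>v (snd z) - v (fst z)\<bar> * kernel q z"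
    by (simp add: weak_integrand_def abs_mult kernel_nonneg abs_abs_powr_mult_self[symmetric])
  also have "\<dots> \<le> (\<bar>u (snd z) - u (fst z)\<bar> powr p + \<bar>v (snd z) - v (fst z)\<bar> powr p) * kernel q z"
    using assms by (intro mult_right_mono powr_young_le kernel_nonneg) auto
  finally show ?thesis by (simp add: diff_quot_def distrib_right)
qed

text \<open>Converts a pointwise Lipschitz estimate for a nonlinear combination of \<open>f\<close>
  and \<open>g\<close> into an estimate of energy densities.\<close>

lemma diff_quot_le:
  assumes "0 \<le> p" "0 \<le> C"
    and "\<bar>v (snd z) - v (fst z)\<bar> \<le> C * (\<bar>f (snd z) - f (fst z)\<bar> + \<bar>g (snd z) - g (fst z)\<bar>)"
  shows "diff_quot q p v z \<le> (2 * C) powr p * (diff_quot q p f z + diff_quot q p g z)"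
proof -
  let ?f = "\<bar>f (snd z) - f (fst z)\<bar>" and ?g = "\<bar>g (snd z) - g (fst z)\<bar>"
  have "\<bar>v (snd z) - v (fst z)\<bar> powr p \<le> (C * (?f + ?g)) powr p"
    using assms by (intro powr_mono2) auto
  also have "\<dots> = C powr p * (?f + ?g) powr p"
    using assms by (simp add: powr_mult)
  also have "\<dots> \<le> C powr p * (2 powr p * (?f powr p + ?g powr p))"
    using assms by (intro mult_left_mono powr_add_le) auto
  also have "\<dots> = (2 * C) powr p * (?f powr p + ?g powr p)"
    using assms by (simp add: powr_mult)
  finally have "\<bar>v (snd z) - v (fst z)\<bar> powr p * kernel q z
      \<le> (2 * C) powr p * (?f powr p + ?g powr p) * kernel q z"
    by (rule mult_right_mono) (rule kernel_nonneg)
  then show ?thesis by (simp add: diff_quot_def algebra_simps)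
qed

subsection \<open>The kernel away from the diagonal\<close>


text \<open>Decomposition into dyadic annuli: where \<open>2 ^ k * \<delta> \<le> norm z\<close>,
  the integrand is at most \<open>c k\<close>, and the annulus lies in the ball \<open>B k\<close>.
  The resulting series is geometric, with ratio below 1 exactly because \<open>q\<close> exceeds the
  dimension.\<close>

lemma nn_integral_norm_powr_tail:
  fixes \<delta> q :: real
  assumes \<delta>: "0 < \<delta>" and q: "real DIM('a) < q"
  shows "(\<integral>\<^sup>+z. ennreal (1 / norm z powr q) * indicator {z. \<delta> \<le> norm z} z
      \<partial>(lborel :: 'a::euclidean_space measure)) < \<infinity>"
proof -
  define B :: "nat \<Rightarrow> 'a set" where "B k = ball 0 (2 ^ Suc k * \<delta>)" for k
  define c where "c k = 1 / (2 ^ k * \<delta>) powr q" for k :: nat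
  have [measurable]: "B k \<in> sets borel" for k by (simp add: B_def)
  have pw: "ennreal (1 / norm z powr q) * indicator {z. \<delta> \<le> norm z} z
      \<le> (\<Sum>k. ennreal (c k) * indicator (B k) z)" for z :: 'a
  proof (cases "\<delta> \<le> norm z")
    case True
    obtain n where n: "norm z / \<delta> < 2 ^ n"
      using real_arch_pow[of 2 "norm z / \<delta>"] by auto
    \<comment> \<open>The annulus of \<open>z\<close> has index \<open>m - 1\<close>, and
      \<open>m\<close> is not 0 since \<open>\<delta> \<le> norm z\<close>.\<close>
    define m where "m = (LEAST n. norm z / \<delta> < 2 ^ n)"
    have m: "norm z / \<delta> < 2 ^ m" unfolding m_def using n by (rule LeastI)
    have "m \<noteq> 0" using m True \<delta> by (intro notI) (simp add: field_simps)
    then obtain k where k: "m = Suc k" by (cases m) auto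
    have "\<not> norm z / \<delta> < 2 ^ k"
      using not_less_Least[of k "\<lambda>n. norm z / \<delta> < 2 ^ n"] k by (simp add: m_def)
    then have ge: "2 ^ k * \<delta> \<le> norm z" using \<delta> by (simp add: field_simps)
    have "norm z > 0" using True \<delta> by linarith
    have "z \<in> B k" using m \<delta> by (simp add: B_def k field_simps)
    moreover have "1 / norm z powr q \<le> c k"
      unfolding c_def using ge \<delta> q \<open>norm z > 0\<close> by (intro divide_left_mono powr_mono2 mult_pos_pos) auto
    ultimately have "ennreal (1 / norm z powr q) \<le> ennreal (c k) * indicator (B k) z"
      by (simp add: ennreal_leI)
    also have "\<dots> \<le> (\<Sum>k. ennreal (c k) * indicator (B k) z)"
      using sum_le_suminf[of f "{k}" for f :: "nat \<Rightarrow> ennreal", simplified] .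
    finally show ?thesis using True by simp
  qed simp
  define r where "r = 2 ^ DIM('a) / 2 powr q"
  have r: "0 \<le> r" "r < 1"
    using q by (auto simp: r_def powr_realpow[symmetric] intro: powr_less_mono)
  \<comment> \<open>\<open>C\<close> is the term of the series for \<open>k = 0\<close>, and
    \<open>r\<close> is the ratio of consecutive terms.\<close>
  define C where "C = unit_ball_vol (real DIM('a)) * (2 * \<delta>) ^ DIM('a) / \<delta> powr q"
  have C: "0 \<le> C" using \<delta> by (simp add: C_def)
  have "ennreal (c k) * emeasure lborel (B k) = ennreal (C * r ^ k)" for k
  proof -
    have "(2 ^ k * \<delta>) powr q = (2 powr q) ^ k * \<delta> powr q"
      using \<delta> by (simp add: powr_mult powr_power powr_realpow[symmetric] powr_powr mult.commute)
    moreover have "(2 ^ Suc k * \<delta>) ^ DIM('a) = (2 ^ DIM('a)) ^ k * (2 * \<delta>) ^ DIM('a)"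
      by (simp add: power_mult_distrib power_mult[symmetric] mult.commute mult.left_commute)
    ultimately have "c k * (unit_ball_vol (real DIM('a)) * (2 ^ Suc k * \<delta>) ^ DIM('a)) = C * r ^ k"
      by (simp add: c_def C_def r_def power_divide mult_ac)
    moreover have "emeasure lborel (B k)
        = ennreal (unit_ball_vol (real DIM('a)) * (2 ^ Suc k * \<delta>) ^ DIM('a))"
      using \<delta> unfolding B_def by (subst emeasure_ball) auto
    moreover have "0 \<le> c k" by (simp add: c_def)
    ultimately show ?thesis by (simp add: ennreal_mult'[symmetric])
  qed
  then have "(\<integral>\<^sup>+z. (\<Sum>k. ennreal (c k) * indicator (B k) z) \<partial>lborel) = (\<Sum>k. ennreal (C * r ^ k))"
    by (simp add: nn_integral_suminf nn_integral_cmult)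
  also have "\<dots> = ennreal (\<Sum>k. C * r ^ k)"
    using r C by (intro suminf_ennreal2) (auto intro!: summable_mult summable_geometric)
  finally have fin: "(\<integral>\<^sup>+z. (\<Sum>k. ennreal (c k) * indicator (B k) z) \<partial>lborel) < \<infinity>"
    by simp
  have "(\<integral>\<^sup>+z. ennreal (1 / norm z powr q) * indicator {z. \<delta> \<le> norm z} z \<partial>(lborel :: 'a measure))
      \<le> (\<integral>\<^sup>+z. (\<Sum>k. ennreal (c k) * indicator (B k) z) \<partial>lborel)"
    by (intro nn_integral_mono pw)
  with fin show ?thesis by (rule le_less_trans[rotated])
qed

lemma nn_integral_kernel_swap:
  fixes f :: "'a::euclidean_space \<Rightarrow> ennreal"
  assumes [measurable]: "f \<in> borel_measurable borel" "A \<in> sets borel" "B \<in> sets borel"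
  shows "(\<integral>\<^sup>+z. f (snd z) * ennreal (kernel q z) * indicator (B \<times> A) z \<partial>(lborel \<Otimes>\<^sub>M lborel))
    = (\<integral>\<^sup>+z. f (fst z) * ennreal (kernel q z) * indicator (A \<times> B) z \<partial>(lborel \<Otimes>\<^sub>M lborel))"
proof -
  have m: "(\<lambda>z. f (fst z) * ennreal (kernel q z) * indicator (A \<times> B) z)
      \<in> borel_measurable (lborel \<Otimes>\<^sub>M lborel)"
    "(\<lambda>z. f (snd z) * ennreal (kernel q z) * indicator (B \<times> A) z)
      \<in> borel_measurable (lborel \<Otimes>\<^sub>M lborel)"
    by measurable
  have "(\<integral>\<^sup>+z. f (snd z) * ennreal (kernel q z) * indicator (B \<times> A) z \<partial>(lborel \<Otimes>\<^sub>M lborel))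
      = (\<integral>\<^sup>+x. \<integral>\<^sup>+y. f y * ennreal (kernel q (x, y)) * indicator (B \<times> A) (x, y) \<partial>lborel \<partial>lborel)"
    using lborel.nn_integral_fst[OF m(2)] by simp
  also have "\<dots> = (\<integral>\<^sup>+x. \<integral>\<^sup>+y. f y * ennreal (kernel q (y, x)) * indicator (A \<times> B) (y, x)
      \<partial>lborel \<partial>lborel)"
    by (intro nn_integral_cong) (auto simp: kernel_def norm_minus_commute indicator_def)
  also have "\<dots> = (\<integral>\<^sup>+z. f (fst z) * ennreal (kernel q z) * indicator (A \<times> B) z
      \<partial>(lborel \<Otimes>\<^sub>M lborel))"
    using lborel_pair.nn_integral_snd[OF m(1)] by simp
  finally show ?thesis .
qed

text \<open>The compact \<open>K\<close> has positive distance from the closed complement of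
  \<open>\<Omega>\<close>, so integrating the kernel over that complement gives a bound uniform in
  the point of \<open>K\<close>. The constant depends on \<open>K\<close>, and no uniform choice is
  available when \<open>K\<close> exhausts \<open>\<Omega>\<close>.\<close>

lemma nn_integral_kernel_outside:
  fixes \<Omega> K :: "'a::euclidean_space set"
  assumes "open \<Omega>" "compact K" "K \<subseteq> \<Omega>" and q: "real DIM('a) < q"
  obtains C :: real where "0 \<le> C"
    and "\<And>f. f \<in> borel_measurable borel \<Longrightarrow>
      (\<integral>\<^sup>+z. f (fst z) * ennreal (kernel q z) * indicator (K \<times> - \<Omega>) z \<partial>(lborel \<Otimes>\<^sub>M lborel))
        \<le> ennreal C * (\<integral>\<^sup>+x. f x * indicator K x \<partial>lborel)"
proof -
  have [measurable]: "\<Omega> \<in> sets borel" "K \<in> sets borel"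
    using assms by (auto simp: borel_compact)
  obtain \<delta> where \<delta>: "0 < \<delta>" "\<And>x y. x \<in> K \<Longrightarrow> y \<in> - \<Omega> \<Longrightarrow> \<delta> \<le> dist x y"
    using separate_compact_closed[of K "- \<Omega>"] assms by (auto simp: closed_Compl disjoint_eq_subset_Compl)
  define I where "I = (\<integral>\<^sup>+z. ennreal (1 / norm z powr q) * indicator {z. \<delta> \<le> norm z} z
      \<partial>(lborel :: 'a measure))"
  have I: "I < \<infinity>" unfolding I_def by (rule nn_integral_norm_powr_tail) fact+
  have inner: "(\<integral>\<^sup>+y. ennreal (kernel q (x, y)) * indicator (- \<Omega>) y \<partial>lborel) \<le> I" if "x \<in> K" for x
  proof -
    \<comment> \<open>Lebesgue measure is written as its own translate by \<open>x\<close>, so that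
      the tail is recentred at the origin.\<close>
    have "(\<integral>\<^sup>+y. ennreal (kernel q (x, y)) * indicator (- \<Omega>) y \<partial>lborel)
        \<le> (\<integral>\<^sup>+y. ennreal (1 / norm (y - x) powr q) * indicator {z. \<delta> \<le> norm z} (y - x)
          \<partial>distr lborel borel ((+) x))"
      unfolding lborel_distr_plus using \<delta>(2)[OF that]
      by (intro nn_integral_mono)
        (auto simp: kernel_def indicator_def dist_norm norm_minus_commute)
    also have "\<dots> = I"
      unfolding I_def by (subst nn_integral_distr) auto
    finally show ?thesis .
  qed
  show ?thesis
  proof (rule that[of "enn2real I"])
    fix f :: "'a \<Rightarrow> ennreal"
    assume [measurable]: "f \<in> borel_measurable borel"
    have m: "(\<lambda>z. f (fst z) * ennreal (kernel q z) * indicator (K \<times> - \<Omega>) z)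
        \<in> borel_measurable (lborel \<Otimes>\<^sub>M lborel)"
      by measurable
    have "(\<integral>\<^sup>+z. f (fst z) * ennreal (kernel q z) * indicator (K \<times> - \<Omega>) z \<partial>(lborel \<Otimes>\<^sub>M lborel))
        = (\<integral>\<^sup>+x. \<integral>\<^sup>+y. f x * indicator K x * (ennreal (kernel q (x, y)) * indicator (- \<Omega>) y)
          \<partial>lborel \<partial>lborel)"
      unfolding lborel.nn_integral_fst[OF m, symmetric]
      by (intro nn_integral_cong) (simp add: indicator_times mult_ac)
    also have "\<dots> = (\<integral>\<^sup>+x. f x * indicator K x *
        (\<integral>\<^sup>+y. ennreal (kernel q (x, y)) * indicator (- \<Omega>) y \<partial>lborel) \<partial>lborel)"
      by (intro nn_integral_cong nn_integral_cmult) measurable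
    also have "\<dots> \<le> (\<integral>\<^sup>+x. I * (f x * indicator K x) \<partial>lborel)"
    proof (intro nn_integral_mono)
      fix x
      show "f x * indicator K x * (\<integral>\<^sup>+y. ennreal (kernel q (x, y)) * indicator (- \<Omega>) y \<partial>lborel)
          \<le> I * (f x * indicator K x)"
        using mult_left_mono[OF inner, of x "f x"] by (cases "x \<in> K") (simp_all add: mult.commute)
    qed
    also have "\<dots> = I * (\<integral>\<^sup>+x. f x * indicator K x \<partial>lborel)"
      by (intro nn_integral_cmult) measurable
    finally show "(\<integral>\<^sup>+z. f (fst z) * ennreal (kernel q z) * indicator (K \<times> - \<Omega>) z
        \<partial>(lborel \<Otimes>\<^sub>M lborel)) \<le> ennreal (enn2real I) * (\<integral>\<^sup>+x. f x * indicator K x \<partial>lborel)"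
      using I by simp
  qed simp
qed

subsection \<open>Admissible functions in the weak equation\<close>

lemma suminf_le_geometric_finite:
  fixes I :: "nat \<Rightarrow> ennreal"
  assumes "\<And>j. I j \<le> ennreal (2 * (1 / 2) ^ j)"
  shows "(\<Sum>j. I j) < \<infinity>"
proof -
  have "(\<Sum>j. I j) \<le> (\<Sum>j. ennreal (2 * (1 / 2) ^ j))"
    by (intro suminf_le assms) auto
  also have "\<dots> = ennreal (\<Sum>j. 2 * (1 / 2) ^ j)"
    by (intro suminf_ennreal2) (auto intro!: summable_mult summable_geometric)
  finally show ?thesis by (simp add: le_less_trans)
qed

lemma tendsto_zero_of_abs_powr:
  fixes f :: "nat \<Rightarrow> real"
  assumes "(\<lambda>j. \<bar>f j\<bar> powr p) \<longlonglongrightarrow> 0" and "0 < p"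
  shows "f \<longlonglongrightarrow> 0"
proof -
  have "(\<lambda>j. (\<bar>f j\<bar> powr p) powr (1 / p)) \<longlonglongrightarrow> 0 powr (1 / p)"
    using assms by (intro tendsto_powr') auto
  then show ?thesis using assms(2) by (simp add: powr_powr tendsto_rabs_zero_iff)
qed

text \<open>The data of the theorem for a representative that is nonnegative at every point, which
  allows the equation to be written with \<open>u powr (p - 1)\<close>. Finite energy is assumed
  over \<open>\<Omega> \<times> \<Omega>\<close> only, as in the definition of the Sobolev
  space.\<close>

locale nonneg_eigenfunction =
  fixes \<Omega> :: "'a::euclidean_space set" and q p \<mu> :: real and u :: "'a \<Rightarrow> real"
  assumes open_domain: "open \<Omega>"
    and p_ge_2: "2 \<le> p"
    and q_gt_dim: "real DIM('a) < q"
    and u_measurable [measurable]: "u \<in> borel_measurable borel"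
    and u_nonneg: "0 \<le> u x"
    and u_outside: "x \<notin> \<Omega> \<Longrightarrow> u x = 0"
    and u_energy: "gagliardo_energy \<Omega> q p u < \<infinity>"
    and u_Lp: "Lp_energy \<Omega> p u < \<infinity>"
    and u_approx: "0 < \<epsilon> \<Longrightarrow> \<exists>\<phi>\<in>test_functions \<Omega>.
      gagliardo_energy \<Omega> q p (\<lambda>x. \<phi> x - u x) + Lp_energy \<Omega> p (\<lambda>x. \<phi> x - u x) < \<epsilon>"
    and u_nonzero: "\<not> (AE x in lborel. u x = 0)"
    and weak_equation: "\<phi> \<in> test_functions \<Omega> \<Longrightarrow>
      (\<integral>z. weak_integrand q p u \<phi> z \<partial>(lborel \<Otimes>\<^sub>M lborel)) = \<mu> * (\<integral>x. u x powr (p - 1) * \<phi> x \<partial>lborel)"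
begin

lemma domain_measurable [measurable]: "\<Omega> \<in> sets borel"
  using open_domain by simp

lemma Lp_energy_eq:
  assumes "\<And>x. x \<notin> \<Omega> \<Longrightarrow> f x = 0"
  shows "Lp_energy \<Omega> p f = (\<integral>\<^sup>+x. ennreal (\<bar>f x\<bar> powr p) \<partial>lborel)"
  unfolding Lp_energy_def using assms
  by (intro nn_integral_cong) (auto simp: indicator_def)

lemma u_powr_integrable: "integrable lborel (\<lambda>x. u x powr p)"
  using u_Lp u_nonneg by (intro integrableI_nonneg) (auto simp: Lp_energy_eq[OF u_outside])

lemma u_diff_quot_integrable:
  "integrable (lborel \<Otimes>\<^sub>M lborel) (\<lambda>z. indicator (\<Omega> \<times> \<Omega>) z * diff_quot q p u z)"
  using u_energy
  by (intro integrableI_nonneg)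
    (auto simp: gagliardo_energy_eq diff_quot_nonneg ennreal_mult' ennreal_indicator mult.commute)

text \<open>The choice is made in two rounds. The support of \<open>b j\<close> determines a
  constant \<open>C j\<close> for the interaction with the complement, and \<open>a j\<close> then
  approximates \<open>u\<close> so well that its error remains small after multiplication by
  \<open>C j\<close>. Geometric decay of all errors yields the dominating functions
  \<open>S\<close>, \<open>R\<close> and \<open>T\<close>.\<close>

lemma approximating_sequences:
  obtains a b :: "nat \<Rightarrow> 'a \<Rightarrow> real" and S T :: "'a \<times> 'a \<Rightarrow> real" and R :: "'a \<Rightarrow> real"
  where "\<And>j. a j \<in> test_functions \<Omega>" and "\<And>j. b j \<in> test_functions \<Omega>"
    and "integrable (lborel \<Otimes>\<^sub>M lborel) S" and "\<And>z. 0 \<le> S z"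
    and "AE z in lborel \<Otimes>\<^sub>M lborel. \<forall>j. z \<in> \<Omega> \<times> \<Omega> \<longrightarrow>
      diff_quot q p (\<lambda>x. a j x - u x) z \<le> S z \<and> diff_quot q p (\<lambda>x. b j x - u x) z \<le> S z"
    and "integrable lborel R" and "\<And>x. 0 \<le> R x"
    and "AE x in lborel. (\<forall>j. \<bar>a j x - u x\<bar> powr p \<le> R x \<and> \<bar>b j x - u x\<bar> powr p \<le> R x)
      \<and> (\<lambda>j. a j x) \<longlonglongrightarrow> u x \<and> (\<lambda>j. b j x) \<longlonglongrightarrow> u x"
    and "integrable (lborel \<Otimes>\<^sub>M lborel) T" and "\<And>z. 0 \<le> T z"
    and "AE z in lborel \<Otimes>\<^sub>M lborel. \<forall>j. b j (fst z) \<noteq> 0 \<and> snd z \<notin> \<Omega> \<longrightarrow>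
      \<bar>a j (fst z) - u (fst z)\<bar> powr p * kernel q z \<le> T z"
proof -
  let ?err = "\<lambda>\<phi>. gagliardo_energy \<Omega> q p (\<lambda>x. \<phi> x - u x) + Lp_energy \<Omega> p (\<lambda>x. \<phi> x - u x)"
  have "\<forall>j. \<exists>\<phi>. \<phi> \<in> test_functions \<Omega> \<and> ?err \<phi> < ennreal ((1 / 2) ^ j)"
    using u_approx[of "ennreal ((1 / 2) ^ j)" for j] by auto
  then obtain b where b: "\<And>j. b j \<in> test_functions \<Omega>" "\<And>j. ?err (b j) < ennreal ((1 / 2) ^ j)"
    by metis
  define K where "K j = closure {x. b j x \<noteq> 0}" for j
  have K: "compact (K j)" "K j \<subseteq> \<Omega>" for j
    using b(1)[of j] by (auto simp: K_def test_functions_def)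
  have [measurable]: "K j \<in> sets borel" for j using K(1) by (simp add: borel_compact)
  define tail_bound where "tail_bound j C \<longleftrightarrow> 0 \<le> C \<and> (\<forall>f\<in>borel_measurable borel.
      (\<integral>\<^sup>+z. f (fst z) * ennreal (kernel q z) * indicator (K j \<times> - \<Omega>) z \<partial>(lborel \<Otimes>\<^sub>M lborel))
        \<le> ennreal C * (\<integral>\<^sup>+x. f x * indicator (K j) x \<partial>lborel))" for j and C :: real
  have "\<exists>C. tail_bound j C" for j
  proof (rule nn_integral_kernel_outside[OF open_domain K[of j] q_gt_dim])
    fix C :: real
    assume C: "0 \<le> C" "\<And>f. f \<in> borel_measurable borel \<Longrightarrow>
      (\<integral>\<^sup>+z. f (fst z) * ennreal (kernel q z) * indicator (K j \<times> - \<Omega>) z \<partial>(lborel \<Otimes>\<^sub>M lborel))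
        \<le> ennreal C * (\<integral>\<^sup>+x. f x * indicator (K j) x \<partial>lborel)"
    show "\<exists>C. tail_bound j C"
      unfolding tail_bound_def by (intro exI[of _ C] conjI ballI C)
  qed
  then obtain C where "\<And>j. tail_bound j (C j)" by metis
  then have C: "\<And>j. 0 \<le> C j" and tail: "\<And>j f. f \<in> borel_measurable borel \<Longrightarrow>
      (\<integral>\<^sup>+z. f (fst z) * ennreal (kernel q z) * indicator (K j \<times> - \<Omega>) z \<partial>(lborel \<Otimes>\<^sub>M lborel))
        \<le> ennreal (C j) * (\<integral>\<^sup>+x. f x * indicator (K j) x \<partial>lborel)"
    unfolding tail_bound_def by simp_all
  \<comment> \<open>The division absorbs \<open>C j\<close>. The summand 1 avoids a zero denominator
    and keeps the error below \<open>(1 / 2) ^ j\<close> as well.\<close>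
  have "\<forall>j. \<exists>\<phi>. \<phi> \<in> test_functions \<Omega> \<and> ?err \<phi> < ennreal ((1 / 2) ^ j / (1 + C j))"
    using u_approx[of "ennreal ((1 / 2) ^ j / (1 + C j))" for j] C by (auto simp: add_pos_nonneg)
  then obtain a where a: "\<And>j. a j \<in> test_functions \<Omega>"
      "\<And>j. ?err (a j) < ennreal ((1 / 2) ^ j / (1 + C j))"
    by metis
  have [measurable]: "a j \<in> borel_measurable borel" "b j \<in> borel_measurable borel" for j
    using a(1) b(1) by (auto intro: test_functions_measurable)
  have "ennreal ((1 / 2) ^ j / (1 + C j)) \<le> ennreal ((1 / 2) ^ j)" for j
    using C[of j] divide_left_mono[of 1 "1 + C j" "(1 / 2) ^ j"] by (intro ennreal_leI) simp
  then have a_err: "?err (a j) \<le> ennreal ((1 / 2) ^ j)" for j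
    using a(2)[of j] by (meson le_less_trans less_imp_le not_le)
  have two: "x + y \<le> ennreal (2 * (1 / 2) ^ j)"
    if "x \<le> ennreal ((1 / 2) ^ j)" "y \<le> ennreal ((1 / 2) ^ j)" for x y :: ennreal and j
    using add_mono[OF that] by (simp add: ennreal_plus[symmetric] del: ennreal_plus)
  have left: "x \<le> c" if "x + y \<le> c" for x y c :: ennreal
    using that by (meson le_iff_add order_trans)
  have right: "y \<le> c" if "x + y \<le> c" for x y c :: ennreal
    using that left[of y x c] by (simp add: add.commute)

  define e1 where "e1 j z = indicator (\<Omega> \<times> \<Omega>) z *
    (diff_quot q p (\<lambda>x. a j x - u x) z + diff_quot q p (\<lambda>x. b j x - u x) z)" for j z
  have e1_meas: "e1 j \<in> borel_measurable (lborel \<Otimes>\<^sub>M lborel)" for j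
    unfolding e1_def by measurable
  have "(\<integral>\<^sup>+z. ennreal (e1 j z) \<partial>(lborel \<Otimes>\<^sub>M lborel))
      = gagliardo_energy \<Omega> q p (\<lambda>x. a j x - u x) + gagliardo_energy \<Omega> q p (\<lambda>x. b j x - u x)" for j
    unfolding e1_def gagliardo_energy_eq
    by (subst nn_integral_add[symmetric])
      (auto intro!: nn_integral_cong simp: diff_quot_nonneg indicator_def)
  then have "(\<integral>\<^sup>+z. ennreal (e1 j z) \<partial>(lborel \<Otimes>\<^sub>M lborel)) \<le> ennreal (2 * (1 / 2) ^ j)" for j
    using two left[OF a_err[of j]] left[OF less_imp_le[OF b(2)[of j]]] by simp
  then have "(\<Sum>j. \<integral>\<^sup>+z. ennreal (e1 j z) \<partial>(lborel \<Otimes>\<^sub>M lborel)) < \<infinity>"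
    by (rule suminf_le_geometric_finite)
  then obtain S where S: "integrable (lborel \<Otimes>\<^sub>M lborel) S" "\<And>z. 0 \<le> S z"
      "AE z in lborel \<Otimes>\<^sub>M lborel. (\<forall>j. e1 j z \<le> S z) \<and> (\<lambda>j. e1 j z) \<longlonglongrightarrow> 0"
    by (rule summable_dominated[rotated 2]) (auto simp: e1_meas, auto simp: e1_def diff_quot_nonneg)
  have S': "AE z in lborel \<Otimes>\<^sub>M lborel. \<forall>j. z \<in> \<Omega> \<times> \<Omega> \<longrightarrow>
      diff_quot q p (\<lambda>x. a j x - u x) z \<le> S z \<and> diff_quot q p (\<lambda>x. b j x - u x) z \<le> S z"
    using S(3)
  proof eventually_elim
    case (elim z)
    show ?case
    proof (intro allI impI)
      fix j assume "z \<in> \<Omega> \<times> \<Omega>"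
      with elim have "diff_quot q p (\<lambda>x. a j x - u x) z + diff_quot q p (\<lambda>x. b j x - u x) z \<le> S z"
        by (auto simp: e1_def dest!: spec[of _ j])
      then show "diff_quot q p (\<lambda>x. a j x - u x) z \<le> S z \<and> diff_quot q p (\<lambda>x. b j x - u x) z \<le> S z"
        using diff_quot_nonneg[of q p "\<lambda>x. a j x - u x" z] diff_quot_nonneg[of q p "\<lambda>x. b j x - u x" z]
        by linarith
    qed
  qed

  define e2 where "e2 j x = \<bar>a j x - u x\<bar> powr p + \<bar>b j x - u x\<bar> powr p" for j x
  have e2_meas: "e2 j \<in> borel_measurable lborel" for j
    unfolding e2_def by measurable
  have outside: "\<And>x. x \<notin> \<Omega> \<Longrightarrow> a j x - u x = 0" "\<And>x. x \<notin> \<Omega> \<Longrightarrow> b j x - u x = 0" for j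
    using a(1) b(1) test_functions_outside u_outside by fastforce+
  have Lp_err: "Lp_energy \<Omega> p (\<lambda>x. a j x - u x) = (\<integral>\<^sup>+x. ennreal (\<bar>a j x - u x\<bar> powr p) \<partial>lborel)"
    "Lp_energy \<Omega> p (\<lambda>x. b j x - u x) = (\<integral>\<^sup>+x. ennreal (\<bar>b j x - u x\<bar> powr p) \<partial>lborel)" for j
    by (auto intro!: Lp_energy_eq outside)
  have "(\<integral>\<^sup>+x. ennreal (e2 j x) \<partial>lborel)
      = Lp_energy \<Omega> p (\<lambda>x. a j x - u x) + Lp_energy \<Omega> p (\<lambda>x. b j x - u x)" for j
    unfolding e2_def Lp_err
    by (subst nn_integral_add[symmetric]) auto
  then have "(\<integral>\<^sup>+x. ennreal (e2 j x) \<partial>lborel) \<le> ennreal (2 * (1 / 2) ^ j)" for j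
    using two right[OF a_err[of j]] right[OF less_imp_le[OF b(2)[of j]]] by simp
  then have "(\<Sum>j. \<integral>\<^sup>+x. ennreal (e2 j x) \<partial>lborel) < \<infinity>"
    by (rule suminf_le_geometric_finite)
  then obtain R where R: "integrable lborel R" "\<And>x. 0 \<le> R x"
      "AE x in lborel. (\<forall>j. e2 j x \<le> R x) \<and> (\<lambda>j. e2 j x) \<longlonglongrightarrow> 0"
    by (rule summable_dominated[rotated 2]) (auto simp: e2_meas, auto simp: e2_def)
  have R': "AE x in lborel. (\<forall>j. \<bar>a j x - u x\<bar> powr p \<le> R x \<and> \<bar>b j x - u x\<bar> powr p \<le> R x)
      \<and> (\<lambda>j. a j x) \<longlonglongrightarrow> u x \<and> (\<lambda>j. b j x) \<longlonglongrightarrow> u x"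
    using R(3)
  proof eventually_elim
    case (elim x)
    have "(\<lambda>j. \<bar>a j x - u x\<bar> powr p) \<longlonglongrightarrow> 0" "(\<lambda>j. \<bar>b j x - u x\<bar> powr p) \<longlonglongrightarrow> 0"
      by (rule tendsto_sandwich[OF _ _ tendsto_const elim[THEN conjunct2]]; simp add: e2_def)+
    then have "(\<lambda>j. a j x) \<longlonglongrightarrow> u x" "(\<lambda>j. b j x) \<longlonglongrightarrow> u x"
      using p_ge_2 tendsto_zero_of_abs_powr[of "\<lambda>j. a j x - u x" p]
        tendsto_zero_of_abs_powr[of "\<lambda>j. b j x - u x" p]
      by (simp_all add: LIM_zero_iff)
    moreover have "\<bar>a j x - u x\<bar> powr p \<le> R x \<and> \<bar>b j x - u x\<bar> powr p \<le> R x" for j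
      using elim[THEN conjunct1, THEN spec, of j] unfolding e2_def
      by (smt (verit) powr_ge_zero)
    ultimately show ?case by blast
  qed

  \<comment> \<open>The error of \<open>a j\<close> is weighted by the kernel on the support of
    \<open>b j\<close> against the complement. Its integral is at most \<open>C j\<close> times the
    error of \<open>a j\<close> in the \<open>p\<close>-th power norm.\<close>
  define e3 where "e3 j z = indicator (K j \<times> - \<Omega>) z *
    (\<bar>a j (fst z) - u (fst z)\<bar> powr p * kernel q z)" for j z
  have e3_meas: "e3 j \<in> borel_measurable (lborel \<Otimes>\<^sub>M lborel)" for j
    unfolding e3_def by measurable
  have "(\<integral>\<^sup>+z. ennreal (e3 j z) \<partial>(lborel \<Otimes>\<^sub>M lborel)) \<le> ennreal (2 * (1 / 2) ^ j)" for j
  proof -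
    have "(\<integral>\<^sup>+z. ennreal (e3 j z) \<partial>(lborel \<Otimes>\<^sub>M lborel))
        = (\<integral>\<^sup>+z. ennreal (\<bar>a j (fst z) - u (fst z)\<bar> powr p) * ennreal (kernel q z)
          * indicator (K j \<times> - \<Omega>) z \<partial>(lborel \<Otimes>\<^sub>M lborel))"
      unfolding e3_def
      by (intro nn_integral_cong) (auto simp: indicator_def ennreal_mult kernel_nonneg)
    also have "\<dots> \<le> ennreal (C j) * (\<integral>\<^sup>+x. ennreal (\<bar>a j x - u x\<bar> powr p) * indicator (K j) x \<partial>lborel)"
      by (rule tail[of "\<lambda>x. ennreal (\<bar>a j x - u x\<bar> powr p)"]) measurable
    also have "\<dots> \<le> ennreal (C j) * Lp_energy \<Omega> p (\<lambda>x. a j x - u x)"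
      unfolding Lp_err
      by (intro mult_left_mono nn_integral_mono) (auto simp: indicator_def)
    also have "\<dots> \<le> ennreal (C j) * ennreal ((1 / 2) ^ j / (1 + C j))"
      by (intro mult_left_mono right[OF less_imp_le[OF a(2)]]) auto
    also have "\<dots> = ennreal (C j * ((1 / 2) ^ j / (1 + C j)))"
      using C[of j] by (intro ennreal_mult[symmetric]) auto
    also have "\<dots> \<le> ennreal (2 * (1 / 2) ^ j)"
    proof (intro ennreal_leI)
      have "C j * (1 / 2) ^ j \<le> 2 * (1 / 2) ^ j * (1 + C j)"
        using C[of j] by (simp add: distrib_left)
      then show "C j * ((1 / 2) ^ j / (1 + C j)) \<le> 2 * (1 / 2) ^ j"
        using C[of j] by (simp add: divide_le_eq)
    qed
    finally show ?thesis .
  qed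
  then have "(\<Sum>j. \<integral>\<^sup>+z. ennreal (e3 j z) \<partial>(lborel \<Otimes>\<^sub>M lborel)) < \<infinity>"
    by (rule suminf_le_geometric_finite)
  then obtain T where T: "integrable (lborel \<Otimes>\<^sub>M lborel) T" "\<And>z. 0 \<le> T z"
      "AE z in lborel \<Otimes>\<^sub>M lborel. (\<forall>j. e3 j z \<le> T z) \<and> (\<lambda>j. e3 j z) \<longlonglongrightarrow> 0"
    by (rule summable_dominated[rotated 2]) (auto simp: e3_meas, auto simp: e3_def kernel_nonneg)
  have T': "AE z in lborel \<Otimes>\<^sub>M lborel. \<forall>j. b j (fst z) \<noteq> 0 \<and> snd z \<notin> \<Omega> \<longrightarrow>
      \<bar>a j (fst z) - u (fst z)\<bar> powr p * kernel q z \<le> T z"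
    using T(3)
  proof eventually_elim
    case (elim z)
    show ?case
    proof (intro allI impI)
      fix j assume j: "b j (fst z) \<noteq> 0 \<and> snd z \<notin> \<Omega>"
      then have "fst z \<in> K j"
        unfolding K_def using closure_subset[of "{x. b j x \<noteq> 0}"] by auto
      with j have "z \<in> K j \<times> - \<Omega>" by (cases z) auto
      then show "\<bar>a j (fst z) - u (fst z)\<bar> powr p * kernel q z \<le> T z"
        using elim[THEN conjunct1, THEN spec, of j] by (simp add: e3_def)
    qed
  qed
  show ?thesis by (rule that[OF a(1) b(1) S(1,2) S' R(1,2) R' T(1,2) T'])
qed

text \<open>A majorant for weak integrands of all \<open>v\<close> bounded by \<open>B\<close>,
  supported in \<open>K\<close>, and with \<open>diff_quot q p v\<close> at most \<open>G\<close> on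
  \<open>\<Omega> \<times> \<Omega>\<close>. Off \<open>\<Omega> \<times> \<Omega>\<close> only the
  pairs joining \<open>K\<close> to the complement contribute, since \<open>v\<close> vanishes at
  both points of any other pair.\<close>

definition dominating :: "real \<Rightarrow> 'a set \<Rightarrow> ('a \<times> 'a \<Rightarrow> real) \<Rightarrow> 'a \<times> 'a \<Rightarrow> real" where
  "dominating B K G z = indicator (\<Omega> \<times> \<Omega>) z * (diff_quot q p u z + G z)
     + indicator (K \<times> - \<Omega>) z * (B * (1 + u (fst z) powr p) * kernel q z)
     + indicator ((- \<Omega>) \<times> K) z * (B * (1 + u (snd z) powr p) * kernel q z)"

text \<open>The outer terms are integrable because \<open>K\<close> stays away from the complement,
  has finite measure, and \<open>u powr p\<close> is integrable. The second of them is the mirror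
  image of the first.\<close>

lemma dominating_integrable:
  assumes K: "compact K" "K \<subseteq> \<Omega>" and B: "0 \<le> B"
    and G: "integrable (lborel \<Otimes>\<^sub>M lborel) (\<lambda>z. indicator (\<Omega> \<times> \<Omega>) z * G z)"
  shows "integrable (lborel \<Otimes>\<^sub>M lborel) (dominating B K G)"
proof -
  have [measurable]: "K \<in> sets borel" using K(1) by (simp add: borel_compact)
  obtain C where tail: "\<And>f. f \<in> borel_measurable borel \<Longrightarrow>
      (\<integral>\<^sup>+z. f (fst z) * ennreal (kernel q z) * indicator (K \<times> - \<Omega>) z \<partial>(lborel \<Otimes>\<^sub>M lborel))
        \<le> ennreal C * (\<integral>\<^sup>+x. f x * indicator K x \<partial>lborel)"
    by (rule nn_integral_kernel_outside[OF open_domain K q_gt_dim]) blast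
  define f where "f x = ennreal (B * (1 + u x powr p))" for x
  have [measurable]: "f \<in> borel_measurable borel" unfolding f_def by measurable
  have "integrable lborel (\<lambda>x. B * (indicator K x + u x powr p))"
    using emeasure_compact_finite[OF K(1)]
    by (intro integrable_mult_right Bochner_Integration.integrable_add integrable_real_indicator u_powr_integrable) auto
  then have "(\<integral>\<^sup>+x. ennreal (B * (indicator K x + u x powr p)) \<partial>lborel) < \<infinity>"
    using B by (subst nn_integral_eq_integral) (auto simp: indicator_def)
  moreover have "(\<integral>\<^sup>+x. f x * indicator K x \<partial>lborel)
      \<le> (\<integral>\<^sup>+x. ennreal (B * (indicator K x + u x powr p)) \<partial>lborel)"
    using B by (intro nn_integral_mono) (auto simp: f_def indicator_def)
  ultimately have "(\<integral>\<^sup>+x. f x * indicator K x \<partial>lborel) < \<infinity>" by (rule le_less_trans[rotated])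
  then have "ennreal C * (\<integral>\<^sup>+x. f x * indicator K x \<partial>lborel) < \<infinity>"
    by (simp add: ennreal_mult_less_top)
  then have fin: "(\<integral>\<^sup>+z. f (fst z) * ennreal (kernel q z) * indicator (K \<times> - \<Omega>) z
      \<partial>(lborel \<Otimes>\<^sub>M lborel)) < \<infinity>"
    using tail[of f] by (auto intro: le_less_trans)
  have outer1: "integrable (lborel \<Otimes>\<^sub>M lborel)
      (\<lambda>z. indicator (K \<times> - \<Omega>) z * (B * (1 + u (fst z) powr p) * kernel q z))"
  proof (rule integrableI_nonneg)
    have "(\<integral>\<^sup>+z. ennreal (indicator (K \<times> - \<Omega>) z * (B * (1 + u (fst z) powr p) * kernel q z))
        \<partial>(lborel \<Otimes>\<^sub>M lborel)) = (\<integral>\<^sup>+z. f (fst z) * ennreal (kernel q z) * indicator (K \<times> - \<Omega>) z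
        \<partial>(lborel \<Otimes>\<^sub>M lborel))"
      using B by (intro nn_integral_cong) (auto simp: f_def indicator_def ennreal_mult kernel_nonneg)
    with fin show "(\<integral>\<^sup>+z. ennreal (indicator (K \<times> - \<Omega>) z * (B * (1 + u (fst z) powr p) * kernel q z))
        \<partial>(lborel \<Otimes>\<^sub>M lborel)) < \<infinity>" by simp
  qed (use B in \<open>auto simp: kernel_nonneg\<close>)
  have outer2: "integrable (lborel \<Otimes>\<^sub>M lborel)
      (\<lambda>z. indicator ((- \<Omega>) \<times> K) z * (B * (1 + u (snd z) powr p) * kernel q z))"
  proof (rule integrableI_nonneg)
    have "(\<integral>\<^sup>+z. ennreal (indicator ((- \<Omega>) \<times> K) z * (B * (1 + u (snd z) powr p) * kernel q z))
        \<partial>(lborel \<Otimes>\<^sub>M lborel)) = (\<integral>\<^sup>+z. f (snd z) * ennreal (kernel q z) * indicator ((- \<Omega>) \<times> K) z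
        \<partial>(lborel \<Otimes>\<^sub>M lborel))"
      using B by (intro nn_integral_cong) (auto simp: f_def indicator_def ennreal_mult kernel_nonneg)
    also have "\<dots> = (\<integral>\<^sup>+z. f (fst z) * ennreal (kernel q z) * indicator (K \<times> - \<Omega>) z
        \<partial>(lborel \<Otimes>\<^sub>M lborel))"
      by (rule nn_integral_kernel_swap) measurable
    finally show "(\<integral>\<^sup>+z. ennreal (indicator ((- \<Omega>) \<times> K) z * (B * (1 + u (snd z) powr p) * kernel q z))
        \<partial>(lborel \<Otimes>\<^sub>M lborel)) < \<infinity>" using fin by simp
  qed (use B in \<open>auto simp: kernel_nonneg\<close>)
  have "integrable (lborel \<Otimes>\<^sub>M lborel) (\<lambda>z. indicator (\<Omega> \<times> \<Omega>) z * (diff_quot q p u z + G z))"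
    unfolding distrib_left by (intro Bochner_Integration.integrable_add u_diff_quot_integrable G)
  then show ?thesis
    unfolding dominating_def[abs_def] by (intro Bochner_Integration.integrable_add outer1 outer2)
qed

lemma u_powr_pred_le: "u x powr (p - 1) \<le> 1 + u x powr p"
  using powr_young_le[of "u x" 1 p] u_nonneg[of x] p_ge_2 by simp

text \<open>Both \<open>u\<close> and \<open>v\<close> vanish at the outer point. The resulting
  product has the sign of \<open>v\<close>, which is what makes Fatou's lemma applicable
  later.\<close>

lemma weak_integrand_outer:
  assumes "\<And>x. x \<notin> \<Omega> \<Longrightarrow> v x = 0" and "snd z \<notin> \<Omega>"
  shows "weak_integrand q p u v z = u (fst z) powr (p - 1) * v (fst z) * kernel q z"
  using assms abs_powr_mult_self[OF u_nonneg, of "fst z" p] u_outside[OF assms(2)]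
  by (simp add: weak_integrand_def u_nonneg)

lemma weak_integrand_outer':
  assumes "\<And>x. x \<notin> \<Omega> \<Longrightarrow> v x = 0" and "fst z \<notin> \<Omega>"
  shows "weak_integrand q p u v z = u (snd z) powr (p - 1) * v (snd z) * kernel q z"
  using assms abs_powr_mult_self[OF u_nonneg, of "snd z" p] u_outside[OF assms(2)]
  by (simp add: weak_integrand_def u_nonneg)

lemma abs_weak_integrand_le_dominating:
  assumes "K \<subseteq> \<Omega>" "\<And>x. \<bar>v x\<bar> \<le> B" "\<And>x. x \<notin> K \<Longrightarrow> v x = 0"
    and "z \<in> \<Omega> \<times> \<Omega> \<Longrightarrow> diff_quot q p v z \<le> G z"
  shows "\<bar>weak_integrand q p u v z\<bar> \<le> dominating B K G z"
proof -
  have v0: "\<And>x. x \<notin> \<Omega> \<Longrightarrow> v x = 0" using assms(1,3) by blast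
  have bound: "\<bar>u x powr (p - 1) * v x * kernel q z\<bar> \<le> B * (1 + u x powr p) * kernel q z" for x
  proof -
    have "u x powr (p - 1) * \<bar>v x\<bar> \<le> (1 + u x powr p) * B"
      by (intro mult_mono u_powr_pred_le assms(2)) (auto intro: add_nonneg_nonneg)
    then show ?thesis
      by (simp add: abs_mult kernel_nonneg mult_right_mono mult.commute[of B])
  qed
  obtain x y where z: "z = (x, y)" by (cases z)
  \<comment> \<open>In the last two cases neither point lies in \<open>K\<close>, or the pair falls
    under an earlier case as well; the integrand is zero there.\<close>
  consider "x \<in> \<Omega>" "y \<in> \<Omega>" | "x \<in> K" "y \<notin> \<Omega>" | "x \<notin> \<Omega>" "y \<in> K"
    | "x \<notin> K" "y \<notin> \<Omega>" | "x \<notin> \<Omega>" "y \<notin> K" by blast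
  then show ?thesis
  proof cases
    case 1
    then show ?thesis
      using abs_weak_integrand_le[of p q u v z] assms(4) p_ge_2
      by (simp add: dominating_def z)
  next
    case 2
    then have "x \<in> \<Omega>" using assms(1) by auto
    with 2 show ?thesis
      using weak_integrand_outer[OF v0, where z = z] bound[of x] by (simp add: dominating_def z)
  next
    case 3
    then have "y \<in> \<Omega>" using assms(1) by auto
    with 3 show ?thesis
      using weak_integrand_outer'[OF v0, where z = z] bound[of y] by (simp add: dominating_def z)
  next
    case 4
    then have "weak_integrand q p u v z = 0"
      using weak_integrand_outer[OF v0, where z = z] assms(3) by (simp add: z)
    then show ?thesis using 4 bound[of y] by (auto simp: dominating_def z indicator_def)
  next
    case 5
    then have "weak_integrand q p u v z = 0"
      using weak_integrand_outer'[OF v0, where z = z] assms(3) by (simp add: z)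
    then show ?thesis using 5 bound[of x] by (auto simp: dominating_def z indicator_def)
  qed
qed

text \<open>The weak equation alone cannot provide this, because a Bochner integral is 0 by
  convention when the integrand is not integrable.\<close>

lemma test_function_weak_integrable:
  assumes v: "v \<in> test_functions \<Omega>"
    and int: "integrable (lborel \<Otimes>\<^sub>M lborel) (\<lambda>z. indicator (\<Omega> \<times> \<Omega>) z * diff_quot q p v z)"
  shows "integrable (lborel \<Otimes>\<^sub>M lborel) (weak_integrand q p u v)"
proof -
  let ?K = "closure {x. v x \<noteq> 0}"
  have K: "compact ?K" "?K \<subseteq> \<Omega>" using v by (auto simp: test_functions_def)
  obtain B where B: "0 \<le> B" "\<And>x. \<bar>v x\<bar> \<le> B" using test_functions_bounded[OF v] by blast
  have [measurable]: "v \<in> borel_measurable borel" using v by (rule test_functions_measurable)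
  have v0: "v x = 0" if "x \<notin> ?K" for x
    using that closure_subset[of "{x. v x \<noteq> 0}"] by auto
  have bound: "AE z in lborel \<Otimes>\<^sub>M lborel. norm (weak_integrand q p u v z)
      \<le> norm (dominating B ?K (diff_quot q p v) z)"
  proof (intro AE_I2)
    fix z
    show "norm (weak_integrand q p u v z) \<le> norm (dominating B ?K (diff_quot q p v) z)"
      using abs_weak_integrand_le_dominating[where v = v and z = z and G = "diff_quot q p v",
          OF K(2) B(2) v0] by simp
  qed
  show ?thesis
    by (rule Bochner_Integration.integrable_bound[OF dominating_integrable[OF K B(1) int] _ bound])
      measurable
qed

end

subsection \<open>Energy of the eigenfunction\<close>

lemma AE_lborel_pair_swap:
  fixes P :: "'a::euclidean_space \<times> 'a \<Rightarrow> bool"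
  assumes "AE z in lborel \<Otimes>\<^sub>M lborel. P z"
  shows "AE z in lborel \<Otimes>\<^sub>M lborel. P (snd z, fst z)"
proof -
  have "AE z in distr (lborel \<Otimes>\<^sub>M lborel) (lborel \<Otimes>\<^sub>M lborel) (\<lambda>(x, y). (y, x :: 'a)). P z"
    using assms by (subst (asm) lborel_pair.distr_pair_swap)
  from AE_distrD[OF measurable_pair_swap' this] show ?thesis
    by (simp add: split_beta)
qed

text \<open>With \<open>A = smooth_abs d s - d\<close> and \<open>B = smooth_abs d t - d\<close>
  this is \<open>2 * A * B / (A + B + d)\<close>, a regularised harmonic mean of the absolute
  values. Like the minimum it vanishes with either argument and is at most twice either absolute
  value. It is smooth, and it tends to the common limit when both arguments do.\<close>

definition smooth_min :: "real \<Rightarrow> real \<Rightarrow> real \<Rightarrow> real" where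
  "smooth_min d s t = 2 * (smooth_abs d s - d) * (smooth_abs d t - d)
     / (smooth_abs d s + smooth_abs d t - d)"

lemma smooth_min_denominator: "0 < d \<Longrightarrow> 0 < smooth_abs d s + smooth_abs d t - d"
  using smooth_abs_ge(2)[of d s] smooth_abs_ge(2)[of d t] by linarith

lemma smooth_min_nonneg: "0 < d \<Longrightarrow> 0 \<le> smooth_min d s t"
  unfolding smooth_min_def
  by (intro divide_nonneg_pos mult_nonneg_nonneg smooth_min_denominator)
    (auto simp: smooth_abs_ge)

lemma smooth_min_le: assumes "0 < d" shows "smooth_min d s t \<le> 2 * \<bar>s\<bar>"
proof -
  have "smooth_min d s t \<le> 2 * (smooth_abs d s - d) * 1"
    unfolding smooth_min_def times_divide_eq_right[symmetric]
    using assms smooth_abs_ge(2)[of d s] smooth_min_denominator[OF assms, of s t]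
    by (intro mult_left_mono) auto
  also have "\<dots> \<le> 2 * \<bar>s\<bar>" using smooth_abs_le[of d s] assms by simp
  finally show ?thesis .
qed

lemma smooth_min_0: "0 < d \<Longrightarrow> smooth_min d s 0 = 0"
  by (simp add: smooth_min_def smooth_abs_0)

text \<open>One variable is changed at a time. The difference then factors into
  \<open>2 * (A - A')\<close> and two fractions between 0 and 1, so the constant is independent of
  \<open>d\<close>.\<close>

lemma smooth_min_lipschitz:
  assumes d: "0 < d"
  shows "\<bar>smooth_min d s t - smooth_min d s' t'\<bar> \<le> 2 * (\<bar>s - s'\<bar> + \<bar>t - t'\<bar>)"
proof -
  have step: "\<bar>2 * A * B / (A + B + d) - 2 * A' * B / (A' + B + d)\<bar> \<le> 2 * \<bar>A - A'\<bar>"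
    if "0 \<le> A" "0 \<le> A'" "0 \<le> B" for A A' B :: real
  proof -
    have pos: "0 < A + B + d" "0 < A' + B + d" using that d by auto
    have "2 * A * B / (A + B + d) - 2 * A' * B / (A' + B + d)
        = (B / (A + B + d)) * ((B + d) / (A' + B + d)) * (2 * (A - A'))"
      using pos by (simp add: divide_simps) (simp add: algebra_simps)
    also have "\<bar>\<dots>\<bar> = \<bar>B / (A + B + d)\<bar> * \<bar>(B + d) / (A' + B + d)\<bar> * (2 * \<bar>A - A'\<bar>)"
      by (simp only: abs_mult abs_numeral)
    also have "\<dots> \<le> 1 * 1 * (2 * \<bar>A - A'\<bar>)"
      using pos that d by (intro mult_right_mono mult_mono) auto
    finally show ?thesis by simp
  qed
  define A B A' B' where "A = smooth_abs d s - d" and "B = smooth_abs d t - d"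
    and "A' = smooth_abs d s' - d" and "B' = smooth_abs d t' - d"
  have nn: "0 \<le> A" "0 \<le> B" "0 \<le> A'" "0 \<le> B'"
    by (simp_all add: A_def B_def A'_def B'_def smooth_abs_ge)
  have "\<bar>2 * A * B / (A + B + d) - 2 * A' * B' / (A' + B' + d)\<bar>
      \<le> \<bar>2 * A * B / (A + B + d) - 2 * A' * B / (A' + B + d)\<bar>
        + \<bar>2 * A' * B / (A' + B + d) - 2 * A' * B' / (A' + B' + d)\<bar>"
    by linarith
  also have "\<dots> \<le> 2 * \<bar>A - A'\<bar> + 2 * \<bar>B - B'\<bar>"
    using step[of A A' B] step[of B B' A'] nn by (simp add: mult_ac add_ac)
  also have "\<dots> \<le> 2 * (\<bar>s - s'\<bar> + \<bar>t - t'\<bar>)"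
    using smooth_abs_lipschitz[of d s s'] smooth_abs_lipschitz[of d t t']
    by (simp add: A_def A'_def B_def B'_def)
  finally show ?thesis
    by (simp add: smooth_min_def A_def A'_def B_def B'_def algebra_simps)
qed

text \<open>For \<open>l > 0\<close> the limit is the harmonic mean of \<open>l\<close> with itself.
  For \<open>l = 0\<close> the limiting denominator vanishes, and squeezing between 0 and
  \<open>2 * \<bar>f j\<bar>\<close> takes over.\<close>

lemma tendsto_smooth_min:
  assumes d: "d \<longlonglongrightarrow> 0" "\<And>j. 0 < d j" and f: "f \<longlonglongrightarrow> l" and g: "g \<longlonglongrightarrow> l" and l: "0 \<le> l"
  shows "(\<lambda>j. smooth_min (d j) (f j) (g j)) \<longlonglongrightarrow> l"
proof (cases "l = 0")
  case True
  have "(\<lambda>j. 2 * \<bar>f j\<bar>) \<longlonglongrightarrow> 2 * \<bar>l\<bar>"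
    using f by (intro tendsto_intros)
  then have lim: "(\<lambda>j. 2 * \<bar>f j\<bar>) \<longlonglongrightarrow> 0" using True by simp
  show ?thesis
    unfolding True
    by (rule tendsto_sandwich[OF _ _ tendsto_const lim])
      (simp_all add: smooth_min_nonneg smooth_min_le d)
next
  case False
  have "(\<lambda>j. smooth_min (d j) (f j) (g j)) \<longlonglongrightarrow> 2 * (\<bar>l\<bar> - 0) * (\<bar>l\<bar> - 0) / (\<bar>l\<bar> + \<bar>l\<bar> - 0)"
    unfolding smooth_min_def using d f g False l
    by (intro tendsto_intros tendsto_smooth_abs) auto
  then show ?thesis using False l by simp
qed

lemma times_cont_diff_smooth_min:
  assumes "times_cont_diff k f" "times_cont_diff k g" "0 < d"
  shows "times_cont_diff k (\<lambda>x. smooth_min d (f x) (g x))"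
proof -
  have sub: "times_cont_diff k (\<lambda>x. smooth_abs d (h x) + - d)" if "times_cont_diff k h" for h
    using assms(3) that by (intro times_cont_diff_add times_cont_diff_smooth_abs times_cont_diff_const)
  have "times_cont_diff k (\<lambda>x. 2 * ((smooth_abs d (f x) + - d) * ((smooth_abs d (g x) + - d)
      * (smooth_abs d (f x) + (smooth_abs d (g x) + - d)) powr (- 1))))"
    using assms smooth_min_denominator[OF assms(3)]
    by (intro times_cont_diff_mult times_cont_diff_powr times_cont_diff_add[of k "\<lambda>x. smooth_abs d (f x)"]
        times_cont_diff_const sub times_cont_diff_smooth_abs) (auto simp: algebra_simps)
  moreover have "smooth_min d (f x) (g x) = 2 * ((smooth_abs d (f x) + - d) * ((smooth_abs d (g x) + - d)
      * (smooth_abs d (f x) + (smooth_abs d (g x) + - d)) powr (- 1)))" for x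
    using smooth_min_denominator[OF assms(3), of "f x" "g x"]
    by (simp add: smooth_min_def powr_minus_divide add_diff_eq)
  ultimately show ?thesis by simp
qed

context nonneg_eigenfunction
begin

text \<open>The kernel is not integrable near the boundary, so closeness of test functions to \<open>u\<close> over
  \<open>\<Omega> \<times> \<Omega>\<close> does not control the energy over the whole space. Taking the minimum of a test function
  \<open>b\<close> and of a test function that approximates \<open>u\<close> well on the scale given by the support of \<open>b\<close>
  repairs this.\<close>

lemma strong_approximation:
  obtains w :: "nat \<Rightarrow> 'a \<Rightarrow> real" and S T :: "'a \<times> 'a \<Rightarrow> real" and R :: "'a \<Rightarrow> real" and c :: real
  where "\<And>j. w j \<in> test_functions \<Omega>" and "\<And>j x. 0 \<le> w j x"
    and "integrable lborel R"
    and "AE x in lborel. (\<lambda>j. w j x) \<longlonglongrightarrow> u x \<and> (\<forall>j. w j x powr p \<le> R x)"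
    and "integrable (lborel \<Otimes>\<^sub>M lborel) (\<lambda>z. indicator (\<Omega> \<times> \<Omega>) z * S z)" and "\<And>z. 0 \<le> S z"
    and "AE z in lborel \<Otimes>\<^sub>M lborel. \<forall>j. z \<in> \<Omega> \<times> \<Omega> \<longrightarrow> diff_quot q p (w j) z \<le> S z"
    and "integrable (lborel \<Otimes>\<^sub>M lborel) T" and "\<And>z. 0 \<le> T z" and "0 \<le> c"
    and "AE z in lborel \<Otimes>\<^sub>M lborel. \<forall>j. z \<notin> \<Omega> \<times> \<Omega> \<longrightarrow>
      diff_quot q p (w j) z \<le> T z + c * diff_quot q p u z"
proof -
  obtain a b :: "nat \<Rightarrow> 'a \<Rightarrow> real" and S T :: "'a \<times> 'a \<Rightarrow> real" and R :: "'a \<Rightarrow> real" where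
    a: "\<And>j. a j \<in> test_functions \<Omega>" and b: "\<And>j. b j \<in> test_functions \<Omega>"
    and S: "integrable (lborel \<Otimes>\<^sub>M lborel) S" "\<And>z. 0 \<le> S z"
      "AE z in lborel \<Otimes>\<^sub>M lborel. \<forall>j. z \<in> \<Omega> \<times> \<Omega> \<longrightarrow>
      diff_quot q p (\<lambda>x. a j x - u x) z \<le> S z \<and> diff_quot q p (\<lambda>x. b j x - u x) z \<le> S z"
    and R: "integrable lborel R" "\<And>x. 0 \<le> R x"
      "AE x in lborel. (\<forall>j. \<bar>a j x - u x\<bar> powr p \<le> R x \<and> \<bar>b j x - u x\<bar> powr p \<le> R x)
      \<and> (\<lambda>j. a j x) \<longlonglongrightarrow> u x \<and> (\<lambda>j. b j x) \<longlonglongrightarrow> u x"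
    and T: "integrable (lborel \<Otimes>\<^sub>M lborel) T" "\<And>z. 0 \<le> T z"
      "AE z in lborel \<Otimes>\<^sub>M lborel. \<forall>j. b j (fst z) \<noteq> 0 \<and> snd z \<notin> \<Omega> \<longrightarrow>
      \<bar>a j (fst z) - u (fst z)\<bar> powr p * kernel q z \<le> T z"
    by (rule approximating_sequences) blast
  define d where "d j = inverse (real (Suc j))" for j
  have d: "0 < d j" "d \<longlonglongrightarrow> 0" for j
    unfolding d_def using LIMSEQ_inverse_real_of_nat by auto
  \<comment> \<open>\<open>w j\<close> takes its support from \<open>b j\<close> and its size from
    \<open>a j\<close>: exactly the pair of properties for which \<open>T\<close> was built.\<close>
  define w where "w j x = smooth_min (d j) (a j x) (b j x)" for j x
  \<comment> \<open>One factor \<open>2 powr p\<close> comes from \<open>smooth_min_le\<close>, the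
    other from splitting \<open>a j\<close> into \<open>a j - u\<close> and
    \<open>u\<close>.\<close>
  define c where "c = 4 powr p"
  have w_test: "w j \<in> test_functions \<Omega>" for j
    unfolding w_def
    by (intro test_functionsI[OF b[of j]] times_cont_diff_smooth_min d
        test_functions_times_cont_diff[OF a] test_functions_times_cont_diff[OF b])
      (simp add: smooth_min_0 d)
  have w_nonneg: "0 \<le> w j x" for j x by (simp add: w_def smooth_min_nonneg d)
  have w_powr: "w j x powr p \<le> c * (\<bar>a j x - u x\<bar> powr p + u x powr p)" for j x
  proof -
    have "w j x \<le> 2 * (\<bar>a j x - u x\<bar> + u x)"
      using smooth_min_le[OF d(1), of j "a j x" "b j x"] u_nonneg[of x]
        abs_triangle_ineq[of "a j x - u x" "u x"] unfolding w_def by simp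
    then have "w j x powr p \<le> (2 * (\<bar>a j x - u x\<bar> + u x)) powr p"
      using p_ge_2 w_nonneg by (intro powr_mono2) auto
    also have "\<dots> = 2 powr p * (\<bar>a j x - u x\<bar> + u x) powr p"
      by (rule powr_mult)
    also have "\<dots> \<le> 2 powr p * (2 powr p * (\<bar>a j x - u x\<bar> powr p + u x powr p))"
      using p_ge_2 u_nonneg[of x] by (intro mult_left_mono powr_add_le) auto
    also have "\<dots> = c * (\<bar>a j x - u x\<bar> powr p + u x powr p)"
      by (simp add: c_def powr_mult[symmetric] flip: mult.assoc)
    finally show ?thesis .
  qed
  have c: "0 \<le> c" by (simp add: c_def)

  have R': "AE x in lborel. (\<lambda>j. w j x) \<longlonglongrightarrow> u x \<and> (\<forall>j. w j x powr p \<le> c * (R x + u x powr p))"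
    using R(3)
  proof eventually_elim
    case (elim x)
    then have "(\<lambda>j. w j x) \<longlonglongrightarrow> u x"
      unfolding w_def by (intro tendsto_smooth_min d u_nonneg) auto
    moreover have "w j x powr p \<le> c * (R x + u x powr p)" for j
      by (rule order_trans[OF w_powr]) (use elim c in \<open>auto intro: mult_left_mono\<close>)
    ultimately show ?case by blast
  qed

  \<comment> \<open>Splitting off \<open>u\<close> costs \<open>2 powr p\<close>. The Lipschitz
    constant 2 costs \<open>4 powr p\<close>, and a second \<open>4 powr p\<close> absorbs the
    factor 2 from adding the bounds for \<open>a j\<close> and \<open>b j\<close>.\<close>
  define S' where "S' z = 16 powr p * (2 powr p * (S z + diff_quot q p u z))" for z
  have S': "AE z in lborel \<Otimes>\<^sub>M lborel. \<forall>j. z \<in> \<Omega> \<times> \<Omega> \<longrightarrow> diff_quot q p (w j) z \<le> S' z"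
    using S(3)
  proof eventually_elim
    case (elim z)
    show ?case
    proof (intro allI impI)
      fix j assume "z \<in> \<Omega> \<times> \<Omega>"
      with elim have S_bound: "diff_quot q p (\<lambda>x. a j x - u x) z \<le> S z"
        "diff_quot q p (\<lambda>x. b j x - u x) z \<le> S z" by auto
      have split: "diff_quot q p f z \<le> 2 powr p * (S z + diff_quot q p u z)"
        if "diff_quot q p (\<lambda>x. f x - u x) z \<le> S z" for f
      proof -
        have "diff_quot q p f z
            \<le> (2 * 1) powr p * (diff_quot q p (\<lambda>x. f x - u x) z + diff_quot q p u z)"
          using p_ge_2 by (intro diff_quot_le) auto
        also have "\<dots> \<le> (2 * 1) powr p * (S z + diff_quot q p u z)"
          using that by (intro mult_left_mono) auto
        finally show ?thesis by simp
      qed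
      have "diff_quot q p (w j) z \<le> (2 * 2) powr p * (diff_quot q p (a j) z + diff_quot q p (b j) z)"
        using p_ge_2 smooth_min_lipschitz[OF d(1)] by (intro diff_quot_le) (auto simp: w_def)
      also have "\<dots> \<le> 4 powr p * (2 powr p * (S z + diff_quot q p u z) + 2 powr p * (S z + diff_quot q p u z))"
        using add_mono[OF split[OF S_bound(1)] split[OF S_bound(2)]]
        by (simp add: mult_left_mono)
      also have "\<dots> = 4 powr p * 2 * (2 powr p * (S z + diff_quot q p u z))"
        by simp
      also have "\<dots> \<le> S' z"
      proof -
        have "4 powr p * 2 \<le> 4 powr p * 4 powr p"
          using powr_mono[of 1 p 4] p_ge_2 by (intro mult_left_mono) auto
        also have "\<dots> = 16 powr p" by (simp add: powr_mult[symmetric])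
        finally show ?thesis
          unfolding S'_def using S(2)[of z] by (intro mult_right_mono) (auto simp: diff_quot_nonneg)
      qed
      finally show "diff_quot q p (w j) z \<le> S' z" .
    qed
  qed
  have S'_int: "integrable (lborel \<Otimes>\<^sub>M lborel) (\<lambda>z. indicator (\<Omega> \<times> \<Omega>) z * S' z)"
  proof -
    have "integrable (lborel \<Otimes>\<^sub>M lborel) (\<lambda>z. indicator (\<Omega> \<times> \<Omega>) z *\<^sub>R S z)"
      by (intro integrable_mult_indicator S) auto
    then have "integrable (lborel \<Otimes>\<^sub>M lborel) (\<lambda>z. 16 powr p * (2 powr p *
        (indicator (\<Omega> \<times> \<Omega>) z * S z + indicator (\<Omega> \<times> \<Omega>) z * diff_quot q p u z)))"
      by (intro integrable_mult_right Bochner_Integration.integrable_add u_diff_quot_integrable) simp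
    then show ?thesis by (simp add: S'_def algebra_simps)
  qed

  \<comment> \<open>\<open>T\<close> controls only pairs whose second point lies outside
    \<open>\<Omega>\<close>; symmetrising covers the other order.\<close>
  define T' where "T' z = c * (T z + T (snd z, fst z))" for z
  have T'_int: "integrable (lborel \<Otimes>\<^sub>M lborel) T'"
    using lborel_pair.integrable_product_swap[OF T(1)] T(1)
    unfolding T'_def[abs_def]
    by (intro integrable_mult_right Bochner_Integration.integrable_add) (simp_all add: split_beta')
  \<comment> \<open>At a pair with a point outside \<open>\<Omega>\<close>, both differences reduce
    to the values at the other point \<open>x\<close>. Where \<open>b j\<close> vanishes so does
    \<open>w j\<close>; elsewhere the bound \<open>t\<close> is available.\<close>
  have side: "diff_quot q p (w j) z \<le> c * (t + diff_quot q p u z)"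
    if x: "b j x \<noteq> 0 \<longrightarrow> \<bar>a j x - u x\<bar> powr p * kernel q z \<le> t" and t: "0 \<le> t"
      and wd: "\<bar>w j (snd z) - w j (fst z)\<bar> = w j x" and ud: "\<bar>u (snd z) - u (fst z)\<bar> = u x"
    for j x z t
  proof (cases "b j x = 0")
    case True
    then have "diff_quot q p (w j) z = 0"
      unfolding diff_quot_def wd by (simp add: w_def smooth_min_0 d)
    then show ?thesis using c t by (simp add: diff_quot_nonneg)
  next
    case False
    have "diff_quot q p (w j) z \<le> c * (\<bar>a j x - u x\<bar> powr p + u x powr p) * kernel q z"
      unfolding diff_quot_def wd by (intro mult_right_mono w_powr kernel_nonneg)
    also have "\<dots> = c * (\<bar>a j x - u x\<bar> powr p * kernel q z + diff_quot q p u z)"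
      unfolding diff_quot_def ud by (simp add: algebra_simps)
    also have "\<dots> \<le> c * (t + diff_quot q p u z)"
      using x False c by (intro mult_left_mono) auto
    finally show ?thesis .
  qed
  have w_outside: "w j x = 0" if "x \<notin> \<Omega>" for j x
    using test_functions_outside[OF w_test that] .
  have T': "AE z in lborel \<Otimes>\<^sub>M lborel. \<forall>j. z \<notin> \<Omega> \<times> \<Omega> \<longrightarrow>
      diff_quot q p (w j) z \<le> T' z + c * diff_quot q p u z"
    using T(3) AE_lborel_pair_swap[OF T(3)]
  proof eventually_elim
    case (elim z)
    show ?case
    proof (intro allI impI)
      fix j assume z: "z \<notin> \<Omega> \<times> \<Omega>"
      obtain x y where xy: "z = (x, y)" by (cases z)
      have ker: "kernel q (y, x) = kernel q z"
        by (simp add: kernel_def xy norm_minus_commute)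
      consider "y \<notin> \<Omega>" | "x \<notin> \<Omega>" using z xy by auto
      then have "diff_quot q p (w j) z \<le> c * (T z + diff_quot q p u z)
          \<or> diff_quot q p (w j) z \<le> c * (T (y, x) + diff_quot q p u z)"
      proof cases
        case 1
        then have "diff_quot q p (w j) z \<le> c * (T z + diff_quot q p u z)"
          using elim(1) w_nonneg u_nonneg w_outside u_outside T(2)
          by (intro side[of j x]) (auto simp: xy)
        then show ?thesis ..
      next
        case 2
        then have "diff_quot q p (w j) z \<le> c * (T (y, x) + diff_quot q p u z)"
          using elim(2) w_nonneg u_nonneg w_outside u_outside T(2) ker
          by (intro side[of j y]) (auto simp: xy)
        then show ?thesis ..
      qed
      moreover have "c * T z \<le> T' z" "c * T (y, x) \<le> T' z"
        using c T(2)[of z] T(2)[of "(y, x)"] by (auto simp: T'_def xy intro: mult_left_mono)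
      ultimately show "diff_quot q p (w j) z \<le> T' z + c * diff_quot q p u z"
        by (auto simp: distrib_left)
    qed
  qed
  show ?thesis
  proof (rule that[OF w_test w_nonneg _ R' S'_int _ S' T'_int _ c T'])
    show "integrable lborel (\<lambda>x. c * (R x + u x powr p))"
      by (intro integrable_mult_right Bochner_Integration.integrable_add R u_powr_integrable)
  qed (auto simp: S'_def T'_def S T c diff_quot_nonneg)
qed

end

section \<open>Upper and lower bounds for the energy over the whole space\<close>

lemma weak_integrand_self: "weak_integrand q p u u z = diff_quot q p u z"
proof -
  have "\<bar>t\<bar> powr (p - 2) * t * t = \<bar>t\<bar> powr p" for t :: real
    by (cases "t = 0") (simp_all add: powr_diff power2_eq_square)
  then show ?thesis by (simp add: weak_integrand_def diff_quot_def)
qed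

lemma tendsto_weak_integrand:
  assumes "(\<lambda>j. v j (fst z)) \<longlonglongrightarrow> v' (fst z)" "(\<lambda>j. v j (snd z)) \<longlonglongrightarrow> v' (snd z)"
  shows "(\<lambda>j. weak_integrand q p u (v j) z) \<longlonglongrightarrow> weak_integrand q p u v' z"
  unfolding weak_integrand_def using assms by (intro tendsto_intros)

lemma tendsto_diff_quot:
  assumes "(\<lambda>j. v j (fst z)) \<longlonglongrightarrow> v' (fst z)" "(\<lambda>j. v j (snd z)) \<longlonglongrightarrow> v' (snd z)" "0 < p"
  shows "(\<lambda>j. diff_quot q p (v j) z) \<longlonglongrightarrow> diff_quot q p v' z"
  unfolding diff_quot_def using assms
  by (intro tendsto_mult tendsto_powr' tendsto_rabs tendsto_diff tendsto_const) auto

context nonneg_eigenfunction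
begin

text \<open>The weak integrands of the nonnegative \<open>w j\<close> are nonnegative off
  \<open>\<Omega> \<times> \<Omega>\<close> and at least \<open>- G\<close> on it. Adding the
  integrable \<open>G\<close> therefore permits Fatou's lemma although the energy of
  \<open>u\<close> is not yet known to be finite.\<close>

lemma energy_le_eigenvalue:
  "gagliardo_energy UNIV q p u \<le> ennreal (\<mu> * (\<integral>x. u x powr p \<partial>lborel))"
proof -
  let ?M = "lborel \<Otimes>\<^sub>M (lborel :: 'a measure)"
  obtain w :: "nat \<Rightarrow> 'a \<Rightarrow> real" and S :: "'a \<times> 'a \<Rightarrow> real" and R :: "'a \<Rightarrow> real" where
    w: "\<And>j. w j \<in> test_functions \<Omega>" "\<And>j x. 0 \<le> w j x"
    and R: "integrable lborel R"
      "AE x in lborel. (\<lambda>j. w j x) \<longlonglongrightarrow> u x \<and> (\<forall>j. w j x powr p \<le> R x)"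
    and S: "integrable ?M (\<lambda>z. indicator (\<Omega> \<times> \<Omega>) z * S z)" "\<And>z. 0 \<le> S z"
      "AE z in ?M. \<forall>j. z \<in> \<Omega> \<times> \<Omega> \<longrightarrow> diff_quot q p (w j) z \<le> S z"
    by (rule strong_approximation) blast
  have [measurable]: "w j \<in> borel_measurable borel" for j
    using w(1) by (rule test_functions_measurable)
  define G where "G z = indicator (\<Omega> \<times> \<Omega>) z * (diff_quot q p u z + S z)" for z
  have G: "integrable ?M G"
    unfolding G_def[abs_def] distrib_left
    by (intro Bochner_Integration.integrable_add S u_diff_quot_integrable)
  have G_nonneg: "0 \<le> G z" for z by (simp add: G_def S diff_quot_nonneg)
  have [measurable]: "G \<in> borel_measurable ?M" using G by auto
  have w_int: "integrable ?M (weak_integrand q p u (w j))" for j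
  proof (rule test_function_weak_integrable[OF w(1)])
    have "AE z in ?M. norm (indicator (\<Omega> \<times> \<Omega>) z * diff_quot q p (w j) z)
        \<le> norm (indicator (\<Omega> \<times> \<Omega>) z * S z)"
      using S(3) by eventually_elim (auto simp: indicator_def diff_quot_nonneg S)
    then show "integrable ?M (\<lambda>z. indicator (\<Omega> \<times> \<Omega>) z * diff_quot q p (w j) z)"
      by (intro Bochner_Integration.integrable_bound[OF S(1)]) measurable
  qed
  have w_outside: "w j x = 0" if "x \<notin> \<Omega>" for j x
    using test_functions_outside[OF w(1) that] .
  have lower: "AE z in ?M. \<forall>j. 0 \<le> weak_integrand q p u (w j) z + G z"
    using S(3)
  proof eventually_elim
    case (elim z)
    show ?case
    proof
      fix j
      consider "z \<in> \<Omega> \<times> \<Omega>" | "snd z \<notin> \<Omega>" | "fst z \<notin> \<Omega>" by (cases z) auto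
      then show "0 \<le> weak_integrand q p u (w j) z + G z"
      proof cases
        case 1
        with elim have "diff_quot q p (w j) z \<le> S z" by blast
        with 1 abs_weak_integrand_le[of p q u "w j" z] p_ge_2 show ?thesis
          by (simp add: G_def)
      next
        case 2
        have "weak_integrand q p u (w j) z = u (fst z) powr (p - 1) * w j (fst z) * kernel q z"
          using 2 by (intro weak_integrand_outer w_outside)
        then show ?thesis using w(2) G_nonneg by (simp add: kernel_nonneg)
      next
        case 3
        have "weak_integrand q p u (w j) z = u (snd z) powr (p - 1) * w j (snd z) * kernel q z"
          using 3 by (intro weak_integrand_outer' w_outside)
        then show ?thesis using w(2) G_nonneg by (simp add: kernel_nonneg)
      qed
    qed
  qed
  have "(\<lambda>j. \<integral>x. u x powr (p - 1) * w j x \<partial>lborel) \<longlonglongrightarrow> (\<integral>x. u x powr (p - 1) * u x \<partial>lborel)"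
  proof (rule integral_dominated_convergence[where w = "\<lambda>x. u x powr p + R x"])
    show "AE x in lborel. (\<lambda>j. u x powr (p - 1) * w j x) \<longlonglongrightarrow> u x powr (p - 1) * u x"
      using R(2) by eventually_elim (auto intro: tendsto_intros)
    show "AE x in lborel. norm (u x powr (p - 1) * w j x) \<le> u x powr p + R x" for j
      using R(2)
    proof eventually_elim
      case (elim x)
      have "norm (u x powr (p - 1) * w j x) \<le> u x powr p + w j x powr p"
        using powr_young_le[of "u x" "w j x" p] u_nonneg[of x] w(2)[of j x] p_ge_2
        by (simp add: abs_mult)
      with elim show ?case by (auto intro: order_trans)
    qed
    show "integrable lborel (\<lambda>x. u x powr p + R x)"
      by (intro Bochner_Integration.integrable_add R u_powr_integrable)
  qed measurable
  moreover have "u x powr (p - 1) * u x = u x powr p" for x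
    using p_ge_2 u_nonneg[of x] by (cases "u x = 0") (simp_all add: powr_diff)
  ultimately have lim: "(\<lambda>j. \<mu> * (\<integral>x. u x powr (p - 1) * w j x \<partial>lborel) + (\<integral>z. G z \<partial>?M))
      \<longlonglongrightarrow> \<mu> * (\<integral>x. u x powr p \<partial>lborel) + (\<integral>z. G z \<partial>?M)"
    by (auto intro!: tendsto_intros)

  have "(\<integral>\<^sup>+z. ennreal (diff_quot q p u z) \<partial>?M) + ennreal (\<integral>z. G z \<partial>?M)
      = (\<integral>\<^sup>+z. ennreal (diff_quot q p u z + G z) \<partial>?M)"
    using G G_nonneg
    by (simp add: diff_quot_nonneg nn_integral_add nn_integral_eq_integral[symmetric])
  also have "\<dots> = (\<integral>\<^sup>+z. liminf (\<lambda>j. ennreal (weak_integrand q p u (w j) z + G z)) \<partial>?M)"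
  proof (rule nn_integral_cong_AE)
    show "AE z in ?M. ennreal (diff_quot q p u z + G z)
        = liminf (\<lambda>j. ennreal (weak_integrand q p u (w j) z + G z))"
      using AE_lborel_pair[OF R(2)]
    proof eventually_elim
      case (elim z)
      have "(\<lambda>j. ennreal (weak_integrand q p u (w j) z + G z))
          \<longlonglongrightarrow> ennreal (weak_integrand q p u u z + G z)"
        using elim by (intro tendsto_ennrealI tendsto_add tendsto_const tendsto_weak_integrand) auto
      then show ?case
        unfolding weak_integrand_self by (intro lim_imp_Liminf[symmetric]) auto
    qed
  qed
  also have "\<dots> \<le> liminf (\<lambda>j. \<integral>\<^sup>+z. ennreal (weak_integrand q p u (w j) z + G z) \<partial>?M)"
    by (rule nn_integral_liminf) measurable
  also have "(\<lambda>j. \<integral>\<^sup>+z. ennreal (weak_integrand q p u (w j) z + G z) \<partial>?M)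
      = (\<lambda>j. ennreal (\<mu> * (\<integral>x. u x powr (p - 1) * w j x \<partial>lborel) + (\<integral>z. G z \<partial>?M)))"
  proof
    fix j
    have "(\<integral>\<^sup>+z. ennreal (weak_integrand q p u (w j) z + G z) \<partial>?M)
        = ennreal (\<integral>z. weak_integrand q p u (w j) z + G z \<partial>?M)"
      using lower by (intro nn_integral_eq_integral Bochner_Integration.integrable_add w_int G) auto
    then show "(\<integral>\<^sup>+z. ennreal (weak_integrand q p u (w j) z + G z) \<partial>?M)
        = ennreal (\<mu> * (\<integral>x. u x powr (p - 1) * w j x \<partial>lborel) + (\<integral>z. G z \<partial>?M))"
      using w_int G weak_equation[OF w(1)] by simp
  qed
  also have "liminf \<dots> = ennreal (\<mu> * (\<integral>x. u x powr p \<partial>lborel) + (\<integral>z. G z \<partial>?M))"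
    by (intro lim_imp_Liminf tendsto_ennrealI lim) auto
  finally have le: "gagliardo_energy UNIV q p u + ennreal (\<integral>z. G z \<partial>?M)
      \<le> ennreal (\<mu> * (\<integral>x. u x powr p \<partial>lborel) + (\<integral>z. G z \<partial>?M))"
    by (simp add: gagliardo_energy_UNIV)
  have int_nonneg: "0 \<le> (\<integral>z. G z \<partial>?M)" using G_nonneg by (intro integral_nonneg_AE) auto
  from le have "gagliardo_energy UNIV q p u \<noteq> \<infinity>"
    by (auto simp: top_unique)
  then obtain e where e: "0 \<le> e" "gagliardo_energy UNIV q p u = ennreal e"
    by (cases "gagliardo_energy UNIV q p u") auto
  have "ennreal (e + (\<integral>z. G z \<partial>?M)) \<le> ennreal (\<mu> * (\<integral>x. u x powr p \<partial>lborel) + (\<integral>z. G z \<partial>?M))"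
    using le e int_nonneg by (simp add: ennreal_plus)
  \<comment> \<open>\<open>ennreal\<close> truncates negative numbers to 0. If the right side is
    negative, the comparison still forces \<open>e = 0\<close>.\<close>
  then have "e = 0 \<or> e \<le> \<mu> * (\<integral>x. u x powr p \<partial>lborel)"
    using e(1) int_nonneg by (simp add: ennreal_le_iff2 del: ennreal_plus) linarith
  then show ?thesis
    unfolding e(2) by (auto intro: ennreal_leI)
qed

lemma Lp_energy_u: "Lp_energy UNIV p u = ennreal (\<integral>x. u x powr p \<partial>lborel)"
  using u_powr_integrable u_nonneg
  by (simp add: Lp_energy_def nn_integral_eq_integral)

lemma integral_u_powr_pos: "0 < (\<integral>x. u x powr p \<partial>lborel)"
proof -
  have "(\<integral>x. u x powr p \<partial>lborel) \<noteq> 0"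
    using u_nonzero u_powr_integrable p_ge_2 by (subst integral_nonneg_eq_0_iff_AE) auto
  then show ?thesis
    using integral_nonneg_AE[of "\<lambda>x. u x powr p" lborel] by (simp add: order_less_le)
qed

lemma energy_finite: "gagliardo_energy UNIV q p u < \<infinity>"
  using energy_le_eigenvalue by (auto intro: le_less_trans)


text \<open>As the energy of \<open>u\<close> is now known to be finite, the bound
  \<open>T z + c * diff_quot q p u z\<close> off \<open>\<Omega> \<times> \<Omega>\<close> is
  integrable. Dominated convergence then carries the inequality from the approximants
  \<open>w j\<close> to \<open>u\<close>.\<close>

lemma rayleigh_lower_bound:
  assumes test: "\<And>\<phi>. \<phi> \<in> test_functions \<Omega> \<Longrightarrow>
    \<Lambda> * Lp_energy UNIV p \<phi> \<le> gagliardo_energy UNIV q p \<phi>"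
  shows "\<Lambda> * Lp_energy UNIV p u \<le> gagliardo_energy UNIV q p u"
proof -
  let ?M = "lborel \<Otimes>\<^sub>M (lborel :: 'a measure)"
  obtain w :: "nat \<Rightarrow> 'a \<Rightarrow> real" and S T :: "'a \<times> 'a \<Rightarrow> real" and R :: "'a \<Rightarrow> real" and c where
    w: "\<And>j. w j \<in> test_functions \<Omega>" "\<And>j x. 0 \<le> w j x"
    and R: "integrable lborel R"
      "AE x in lborel. (\<lambda>j. w j x) \<longlonglongrightarrow> u x \<and> (\<forall>j. w j x powr p \<le> R x)"
    and S: "integrable ?M (\<lambda>z. indicator (\<Omega> \<times> \<Omega>) z * S z)" "\<And>z. 0 \<le> S z"
      "AE z in ?M. \<forall>j. z \<in> \<Omega> \<times> \<Omega> \<longrightarrow> diff_quot q p (w j) z \<le> S z"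
    and T: "integrable ?M T" "\<And>z. 0 \<le> T z" "0 \<le> c"
      "AE z in ?M. \<forall>j. z \<notin> \<Omega> \<times> \<Omega> \<longrightarrow> diff_quot q p (w j) z \<le> T z + c * diff_quot q p u z"
    by (rule strong_approximation) blast
  have [measurable]: "w j \<in> borel_measurable borel" for j
    using w(1) by (rule test_functions_measurable)
  define W where "W z = indicator (\<Omega> \<times> \<Omega>) z * S z + (T z + c * diff_quot q p u z)" for z
  have "integrable ?M (diff_quot q p u)"
    using energy_finite
    by (intro integrableI_nonneg) (auto simp: gagliardo_energy_UNIV diff_quot_nonneg)
  then have W: "integrable ?M W"
    unfolding W_def[abs_def]
    by (intro Bochner_Integration.integrable_add integrable_mult_right S T)
  have [measurable]: "W \<in> borel_measurable ?M" using W by auto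
  have W_nonneg: "0 \<le> W z" for z using S T by (simp add: W_def diff_quot_nonneg)
  have "(\<lambda>j. gagliardo_energy UNIV q p (w j)) \<longlonglongrightarrow> gagliardo_energy UNIV q p u"
    unfolding gagliardo_energy_UNIV
  proof (rule nn_integral_dominated_convergence[where w = W])
    show "AE z in ?M. ennreal (diff_quot q p (w j) z) \<le> ennreal (W z)" for j
      using S(3) T(4)
    proof eventually_elim
      case (elim z)
      have "diff_quot q p (w j) z \<le> W z"
        using elim[THEN spec, of j] S(2)[of z] T(2)[of z] T(3) diff_quot_nonneg[of q p u z]
        by (cases "z \<in> \<Omega> \<times> \<Omega>") (auto simp: W_def indicator_def intro: add_increasing2)
      then show ?case by (rule ennreal_leI)
    qed
    show "(\<integral>\<^sup>+z. ennreal (W z) \<partial>?M) < \<infinity>"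
      using W W_nonneg by (simp add: nn_integral_eq_integral)
    show "AE z in ?M. (\<lambda>j. ennreal (diff_quot q p (w j) z)) \<longlonglongrightarrow> ennreal (diff_quot q p u z)"
      using AE_lborel_pair[OF R(2)]
      by eventually_elim (use p_ge_2 in \<open>auto intro!: tendsto_ennrealI tendsto_diff_quot\<close>)
  qed measurable
  moreover have "(\<lambda>j. Lp_energy UNIV p (w j)) \<longlonglongrightarrow> Lp_energy UNIV p u"
    unfolding Lp_energy_def indicator_UNIV mult_1_right
  proof (rule nn_integral_dominated_convergence[where w = R])
    show "AE x in lborel. ennreal (\<bar>w j x\<bar> powr p) \<le> ennreal (R x)" for j
      using R(2) by eventually_elim (auto intro!: ennreal_leI simp: w)
    have "AE x in lborel. 0 \<le> R x"
      using R(2) by eventually_elim (meson order_trans powr_ge_zero)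
    then show "(\<integral>\<^sup>+x. ennreal (R x) \<partial>lborel) < \<infinity>"
      using R(1) by (simp add: nn_integral_eq_integral)
    show "AE x in lborel. (\<lambda>j. ennreal (\<bar>w j x\<bar> powr p)) \<longlonglongrightarrow> ennreal (\<bar>u x\<bar> powr p)"
      using R(2)
      by eventually_elim
        (use p_ge_2 in \<open>auto intro!: tendsto_ennrealI tendsto_powr' tendsto_rabs\<close>)
  qed (use R(1) in measurable)
  \<comment> \<open>\<open>\<Lambda>\<close> may be infinite; the product is continuous here because
    the limit of the second factor is finite and nonzero.\<close>
  then have "(\<lambda>j. \<Lambda> * Lp_energy UNIV p (w j)) \<longlonglongrightarrow> \<Lambda> * Lp_energy UNIV p u"
    using integral_u_powr_pos by (intro tendsto_mult_ennreal tendsto_const) (auto simp: Lp_energy_u)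
  ultimately show ?thesis
    using test[OF w(1)] by (intro LIMSEQ_le) auto
qed

end

subsection \<open>Testing with the Picone quotient\<close>

text \<open>A smooth version of \<open>\<bar>s\<bar> powr p * (\<bar>t\<bar> + \<epsilon>) powr (1 -
  p)\<close>. Subtracting \<open>d powr p\<close> makes it vanish at \<open>s = 0\<close>, so that
  inserting a test function for \<open>s\<close> preserves its support.\<close>

definition smooth_picone :: "real \<Rightarrow> real \<Rightarrow> real \<Rightarrow> real \<Rightarrow> real \<Rightarrow> real" where
  "smooth_picone p d \<epsilon> s t
     = (smooth_abs d s powr p - d powr p) * (smooth_abs d t + \<epsilon>) powr (1 - p)"

lemma smooth_picone_bounds:
  assumes "0 < d" "d \<le> 1" "0 < \<epsilon>" "2 \<le> p" "\<bar>s\<bar> \<le> M"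
  shows "0 \<le> smooth_abs d s powr p - d powr p"
    and "smooth_abs d s powr p - d powr p \<le> (M + 1) powr p"
    and "(smooth_abs d t + \<epsilon>) powr (1 - p) \<le> \<epsilon> powr (1 - p)"
proof -
  show "0 \<le> smooth_abs d s powr p - d powr p"
    using assms smooth_abs_ge(2)[of d s] by (simp add: powr_mono2)
  have "smooth_abs d s powr p \<le> (M + 1) powr p"
    using assms smooth_abs_le[of d s] smooth_abs_ge(2)[of d s] by (intro powr_mono2) auto
  then show "smooth_abs d s powr p - d powr p \<le> (M + 1) powr p"
    using powr_ge_zero[of d p] by linarith
  show "(smooth_abs d t + \<epsilon>) powr (1 - p) \<le> \<epsilon> powr (1 - p)"
    using assms smooth_abs_ge(2)[of d t] by (intro powr_mono2') auto
qed

lemma abs_smooth_picone_le: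
  assumes "0 < d" "d \<le> 1" "0 < \<epsilon>" "2 \<le> p" "\<bar>s\<bar> \<le> M"
  shows "\<bar>smooth_picone p d \<epsilon> s t\<bar> \<le> (M + 1) powr p * \<epsilon> powr (1 - p)"
  using smooth_picone_bounds[OF assms]
  by (auto simp: smooth_picone_def abs_mult intro!: mult_mono)

text \<open>A product of two bounded Lipschitz factors. The constant must not depend on
  \<open>d\<close>, as it enters a majorant common to all members of a sequence with
  \<open>d\<close> tending to 0.\<close>

lemma smooth_picone_lipschitz:
  assumes d: "0 < d" "d \<le> 1" and \<epsilon>: "0 < \<epsilon>" and p: "2 \<le> p"
    and M: "\<bar>s\<bar> \<le> M" "\<bar>s'\<bar> \<le> M"
  shows "\<bar>smooth_picone p d \<epsilon> s t - smooth_picone p d \<epsilon> s' t'\<bar>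
    \<le> (p * (M + 1) powr (p - 1) * \<epsilon> powr (1 - p) + (M + 1) powr p * ((p - 1) * \<epsilon> powr (- p)))
      * (\<bar>s - s'\<bar> + \<bar>t - t'\<bar>)"
proof -
  define F where "F s = smooth_abs d s powr p - d powr p" for s
  define h where "h t = (smooth_abs d t + \<epsilon>) powr (1 - p)" for t
  let ?C1 = "p * (M + 1) powr (p - 1)" and ?C2 = "(p - 1) * \<epsilon> powr (- p)"
  note bounds = smooth_picone_bounds[OF d \<epsilon> p, folded F_def h_def]
  have C1: "0 \<le> ?C1" and C2: "0 \<le> ?C2" using p by auto
  have "\<bar>F s - F s'\<bar> \<le> ?C1 * \<bar>smooth_abs d s - smooth_abs d s'\<bar>"
  proof -
    have "\<bar>smooth_abs d s powr p - smooth_abs d s' powr p\<bar> \<le> ?C1 * \<bar>smooth_abs d s - smooth_abs d s'\<bar>"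
    proof (rule powr_lipschitz[where m = d and M = "M + 1"])
      show "\<bar>p * z powr (p - 1)\<bar> \<le> ?C1" if "d \<le> z" "z \<le> M + 1" for z
        using that d p by (auto simp: abs_mult intro!: mult_left_mono powr_mono2)
    qed (use d M smooth_abs_ge(2)[of d] smooth_abs_le[of d s] smooth_abs_le[of d s'] in auto)
    then show ?thesis by (simp add: F_def)
  qed
  also have "\<dots> \<le> ?C1 * \<bar>s - s'\<bar>"
    by (intro mult_left_mono smooth_abs_lipschitz C1)
  finally have F: "\<bar>F s - F s'\<bar> \<le> ?C1 * \<bar>s - s'\<bar>" .
  have "\<bar>h t - h t'\<bar> \<le> ?C2 * \<bar>(smooth_abs d t + \<epsilon>) - (smooth_abs d t' + \<epsilon>)\<bar>"
    unfolding h_def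
  proof (rule powr_lipschitz[where m = \<epsilon> and M = "max (smooth_abs d t) (smooth_abs d t') + \<epsilon>"])
    show "\<bar>(1 - p) * z powr (1 - p - 1)\<bar> \<le> ?C2" if "\<epsilon> \<le> z" for z
      using that \<epsilon> p by (auto simp: abs_mult intro!: mult_left_mono powr_mono2')
  qed (use d \<epsilon> smooth_abs_ge(2)[of d t] smooth_abs_ge(2)[of d t'] in auto)
  also have "\<dots> \<le> ?C2 * \<bar>t - t'\<bar>"
    using smooth_abs_lipschitz[of d t t'] by (intro mult_left_mono C2) simp
  finally have h: "\<bar>h t - h t'\<bar> \<le> ?C2 * \<bar>t - t'\<bar>" .
  have "F s * h t - F s' * h t' = (F s - F s') * h t + F s' * (h t - h t')"
    by (simp add: algebra_simps)
  then have "\<bar>F s * h t - F s' * h t'\<bar> \<le> \<bar>F s - F s'\<bar> * h t + F s' * \<bar>h t - h t'\<bar>"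
    using bounds(1)[OF M(2)] by (auto simp: h_def abs_mult intro: order_trans[OF abs_triangle_ineq])
  also have "\<dots> \<le> ?C1 * \<bar>s - s'\<bar> * \<epsilon> powr (1 - p) + (M + 1) powr p * (?C2 * \<bar>t - t'\<bar>)"
    using F h bounds[OF M(2)] C1 by (intro add_mono mult_mono) (auto simp: h_def)
  also have "\<dots> \<le> (?C1 * \<epsilon> powr (1 - p) + (M + 1) powr p * ?C2) * (\<bar>s - s'\<bar> + \<bar>t - t'\<bar>)"
  proof -
    have "0 \<le> ?C1 * \<epsilon> powr (1 - p) * \<bar>t - t'\<bar> + (M + 1) powr p * ?C2 * \<bar>s - s'\<bar>"
      using C1 C2 by auto
    then show ?thesis by (simp add: algebra_simps)
  qed
  finally show ?thesis by (simp add: smooth_picone_def F_def h_def)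
qed

lemma tendsto_smooth_picone:
  assumes "d \<longlonglongrightarrow> 0" "\<And>j. 0 < d j" "t \<longlonglongrightarrow> l" "0 \<le> l" "0 < \<epsilon>" "0 < p"
  shows "(\<lambda>j. smooth_picone p (d j) \<epsilon> s (t j)) \<longlonglongrightarrow> \<bar>s\<bar> powr p * (l + \<epsilon>) powr (1 - p)"
proof -
  have "(\<lambda>j. smooth_abs (d j) s powr p) \<longlonglongrightarrow> \<bar>s\<bar> powr p"
    using assms by (intro tendsto_powr' tendsto_smooth_abs tendsto_const)
      (auto intro!: always_eventually order_trans[OF _ smooth_abs_ge(1)])
  moreover have "(\<lambda>j. d j powr p) \<longlonglongrightarrow> 0 powr p"
    using assms by (intro tendsto_powr' tendsto_const) (auto intro!: always_eventually less_imp_le)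
  moreover have "(\<lambda>j. (smooth_abs (d j) (t j) + \<epsilon>) powr (1 - p)) \<longlonglongrightarrow> (\<bar>l\<bar> + \<epsilon>) powr (1 - p)"
    using assms by (intro tendsto_powr tendsto_add tendsto_smooth_abs tendsto_const) auto
  ultimately have "(\<lambda>j. smooth_picone p (d j) \<epsilon> s (t j))
      \<longlonglongrightarrow> (\<bar>s\<bar> powr p - 0 powr p) * (\<bar>l\<bar> + \<epsilon>) powr (1 - p)"
    unfolding smooth_picone_def by (intro tendsto_mult tendsto_diff)
  then show ?thesis using assms by simp
qed

lemma times_cont_diff_smooth_picone:
  assumes "times_cont_diff k f" "times_cont_diff k g" "0 < d" "0 < \<epsilon>"
  shows "times_cont_diff k (\<lambda>x. smooth_picone p d \<epsilon> (f x) (g x))"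
proof -
  have "times_cont_diff k (\<lambda>x. ((smooth_abs d (f x) + 0) powr p + - (d powr p))
      * (smooth_abs d (g x) + \<epsilon>) powr (1 - p))"
    using assms by (intro times_cont_diff_mult times_cont_diff_add times_cont_diff_smooth_abs_powr
        times_cont_diff_const) auto
  then show ?thesis by (simp add: smooth_picone_def)
qed

context nonneg_eigenfunction
begin

text \<open>The Picone quotient is not smooth, so \<open>u\<close> in it is replaced by the test
  functions \<open>b j\<close> and the absolute values are smoothed. All approximants live on the
  support of \<open>\<phi>\<close>, so one constant handles the mixed pairs and closeness of
  \<open>b j\<close> to \<open>u\<close> over \<open>\<Omega> \<times> \<Omega>\<close> is
  enough.\<close>

lemma weak_equation_picone:
  assumes \<phi>: "\<phi> \<in> test_functions \<Omega>" and fin: "gagliardo_energy UNIV q p \<phi> < \<infinity>" and \<epsilon>: "0 < \<epsilon>"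
  defines "v \<equiv> \<lambda>x. \<bar>\<phi> x\<bar> powr p * (u x + \<epsilon>) powr (1 - p)"
  shows "integrable (lborel \<Otimes>\<^sub>M lborel) (weak_integrand q p u v)"
    and "(\<integral>z. weak_integrand q p u v z \<partial>(lborel \<Otimes>\<^sub>M lborel))
      = \<mu> * (\<integral>x. u x powr (p - 1) * v x \<partial>lborel)"
proof -
  let ?M = "lborel \<Otimes>\<^sub>M (lborel :: 'a measure)"
  obtain b :: "nat \<Rightarrow> 'a \<Rightarrow> real" and S :: "'a \<times> 'a \<Rightarrow> real" where
    b: "\<And>j. b j \<in> test_functions \<Omega>" "AE x in lborel. (\<lambda>j. b j x) \<longlonglongrightarrow> u x"
    and S: "integrable ?M S" "\<And>z. 0 \<le> S z"
      "AE z in ?M. \<forall>j. z \<in> \<Omega> \<times> \<Omega> \<longrightarrow> diff_quot q p (\<lambda>x. b j x - u x) z \<le> S z"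
  proof (rule approximating_sequences)
    fix a b :: "nat \<Rightarrow> 'a \<Rightarrow> real" and S T :: "'a \<times> 'a \<Rightarrow> real" and R :: "'a \<Rightarrow> real"
    assume b: "\<And>j. b j \<in> test_functions \<Omega>"
      and R: "AE x in lborel. (\<forall>j. \<bar>a j x - u x\<bar> powr p \<le> R x \<and> \<bar>b j x - u x\<bar> powr p \<le> R x)
        \<and> (\<lambda>j. a j x) \<longlonglongrightarrow> u x \<and> (\<lambda>j. b j x) \<longlonglongrightarrow> u x"
      and S: "integrable ?M S" "\<And>z. 0 \<le> S z"
        "AE z in ?M. \<forall>j. z \<in> \<Omega> \<times> \<Omega> \<longrightarrow>
          diff_quot q p (\<lambda>x. a j x - u x) z \<le> S z \<and> diff_quot q p (\<lambda>x. b j x - u x) z \<le> S z"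
    show thesis
    proof (rule that[OF b _ S(1,2)])
      show "AE x in lborel. (\<lambda>j. b j x) \<longlonglongrightarrow> u x" using R by eventually_elim auto
      show "AE z in ?M. \<forall>j. z \<in> \<Omega> \<times> \<Omega> \<longrightarrow> diff_quot q p (\<lambda>x. b j x - u x) z \<le> S z"
        using S(3) by eventually_elim auto
    qed
  qed
  let ?K = "closure {x. \<phi> x \<noteq> 0}"
  have K: "compact ?K" "?K \<subseteq> \<Omega>" using \<phi> by (auto simp: test_functions_def)
  have \<phi>0: "\<phi> x = 0" if "x \<notin> ?K" for x
    using that closure_subset[of "{x. \<phi> x \<noteq> 0}"] by auto
  obtain M where M: "0 \<le> M" "\<And>x. \<bar>\<phi> x\<bar> \<le> M" using test_functions_bounded[OF \<phi>] by blast
  define d where "d j = inverse (real (Suc j))" for j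
  have d: "0 < d j" "d j \<le> 1" "d \<longlonglongrightarrow> 0" for j
    unfolding d_def using LIMSEQ_inverse_real_of_nat by (auto simp: field_simps)
  define w where "w j x = smooth_picone p (d j) \<epsilon> (\<phi> x) (b j x)" for j x
  have w0: "\<phi> x = 0 \<Longrightarrow> w j x = 0" for j x
    using d(1)[of j] by (simp add: w_def smooth_picone_def smooth_abs_0)
  have w_test: "w j \<in> test_functions \<Omega>" for j
    by (rule test_functionsI[OF \<phi> _ w0])
      (auto simp: w_def[abs_def] intro!: times_cont_diff_smooth_picone d \<epsilon>
        test_functions_times_cont_diff[OF \<phi>] test_functions_times_cont_diff[OF b(1)])
  define B where "B = (M + 1) powr p * \<epsilon> powr (1 - p)"
  have B: "0 \<le> B" "\<bar>w j x\<bar> \<le> B" for j x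
    unfolding B_def w_def using abs_smooth_picone_le[OF d(1,2) \<epsilon> p_ge_2 M(2)] by auto
  define C where "C = p * (M + 1) powr (p - 1) * \<epsilon> powr (1 - p)
    + (M + 1) powr p * ((p - 1) * \<epsilon> powr (- p))"
  have C: "0 \<le> C" using p_ge_2 by (simp add: C_def)
  \<comment> \<open>\<open>C\<close> is the Lipschitz constant of \<open>smooth_picone\<close>, and
    \<open>2 powr p\<close> comes from splitting \<open>b j\<close> into \<open>b j - u\<close> and
    \<open>u\<close>; neither depends on \<open>j\<close>.\<close>
  define G where "G z = (2 * C) powr p * (diff_quot q p \<phi> z + 2 powr p * (S z + diff_quot q p u z))" for z
  have G_bound: "AE z in ?M. \<forall>j. z \<in> \<Omega> \<times> \<Omega> \<longrightarrow> diff_quot q p (w j) z \<le> G z"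
    using S(3)
  proof eventually_elim
    case (elim z)
    show ?case
    proof (intro allI impI)
      fix j assume "z \<in> \<Omega> \<times> \<Omega>"
      with elim have *: "diff_quot q p (\<lambda>x. b j x - u x) z \<le> S z" by blast
      have "diff_quot q p (b j) z
          \<le> (2 * 1) powr p * (diff_quot q p (\<lambda>x. b j x - u x) z + diff_quot q p u z)"
        using p_ge_2 by (intro diff_quot_le) auto
      also have "\<dots> \<le> (2 * 1) powr p * (S z + diff_quot q p u z)"
        using * by (intro mult_left_mono) auto
      finally have "diff_quot q p (b j) z \<le> 2 powr p * (S z + diff_quot q p u z)" by simp
      moreover have "diff_quot q p (w j) z \<le> (2 * C) powr p * (diff_quot q p \<phi> z + diff_quot q p (b j) z)"
        using p_ge_2 C smooth_picone_lipschitz[OF d(1,2) \<epsilon> p_ge_2 M(2) M(2)]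
        by (intro diff_quot_le) (auto simp: w_def C_def)
      ultimately show "diff_quot q p (w j) z \<le> G z"
        unfolding G_def by (elim order_trans) (auto intro: mult_left_mono)
    qed
  qed
  have [measurable]: "\<phi> \<in> borel_measurable borel" "w j \<in> borel_measurable borel" for j
    using \<phi> w_test by (auto intro: test_functions_measurable)
  have [measurable]: "v \<in> borel_measurable borel" unfolding v_def by measurable
  have G_int: "integrable ?M (\<lambda>z. indicator (\<Omega> \<times> \<Omega>) z * G z)"
  proof -
    have "integrable ?M (diff_quot q p \<phi>)"
      using fin by (intro integrableI_nonneg) (auto simp: gagliardo_energy_UNIV diff_quot_nonneg)
    then have "integrable ?M (\<lambda>z. indicator (\<Omega> \<times> \<Omega>) z *\<^sub>R diff_quot q p \<phi> z)"
      by (intro integrable_mult_indicator) auto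
    moreover have "integrable ?M (\<lambda>z. indicator (\<Omega> \<times> \<Omega>) z *\<^sub>R S z)"
      by (intro integrable_mult_indicator S) auto
    ultimately have "integrable ?M (\<lambda>z. (2 * C) powr p * (indicator (\<Omega> \<times> \<Omega>) z * diff_quot q p \<phi> z
        + 2 powr p * (indicator (\<Omega> \<times> \<Omega>) z * S z + indicator (\<Omega> \<times> \<Omega>) z * diff_quot q p u z)))"
      by (intro integrable_mult_right Bochner_Integration.integrable_add u_diff_quot_integrable) auto
    then show ?thesis by (simp add: G_def algebra_simps)
  qed
  have w_lim: "AE x in lborel. (\<lambda>j. w j x) \<longlonglongrightarrow> v x"
    using b(2) by eventually_elim
      (use d \<epsilon> u_nonneg p_ge_2 in \<open>auto simp: w_def v_def intro!: tendsto_smooth_picone\<close>)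
  have lim: "AE z in ?M. (\<lambda>j. weak_integrand q p u (w j) z) \<longlonglongrightarrow> weak_integrand q p u v z"
    using AE_lborel_pair[OF w_lim] by eventually_elim (auto intro: tendsto_weak_integrand)
  have bound: "AE z in ?M. norm (weak_integrand q p u (w j) z) \<le> dominating B ?K G z" for j
    using G_bound
  proof eventually_elim
    case (elim z)
    show ?case
      unfolding real_norm_def
      using elim w0[OF \<phi>0, of _ j]
      by (intro abs_weak_integrand_le_dominating[where v = "w j"] K(2) B(2)) blast+
  qed
  note dct = dominating_integrable[OF K B(1) G_int] lim bound
  show "integrable ?M (weak_integrand q p u v)"
    by (rule integrable_dominated_convergence[OF _ _ dct]) measurable
  have "(\<lambda>j. \<integral>z. weak_integrand q p u (w j) z \<partial>?M) \<longlonglongrightarrow> (\<integral>z. weak_integrand q p u v z \<partial>?M)"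
    by (rule integral_dominated_convergence[OF _ _ dct]) measurable
  then have lim1: "(\<lambda>j. \<mu> * (\<integral>x. u x powr (p - 1) * w j x \<partial>lborel)) \<longlonglongrightarrow> (\<integral>z. weak_integrand q p u v z \<partial>?M)"
    by (simp add: weak_equation[OF w_test])
  have "(\<lambda>j. \<integral>x. u x powr (p - 1) * w j x \<partial>lborel) \<longlonglongrightarrow> (\<integral>x. u x powr (p - 1) * v x \<partial>lborel)"
  proof (rule integral_dominated_convergence[where w = "\<lambda>x. B * (indicator ?K x + u x powr p)"])
    show "integrable lborel (\<lambda>x. B * (indicator ?K x + u x powr p))"
      using emeasure_compact_finite[OF K(1)]
      by (intro integrable_mult_right Bochner_Integration.integrable_add integrable_real_indicator
          u_powr_integrable) auto
    show "AE x in lborel. (\<lambda>j. u x powr (p - 1) * w j x) \<longlonglongrightarrow> u x powr (p - 1) * v x"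
      using w_lim by eventually_elim (auto intro: tendsto_intros)
    show "AE x in lborel. norm (u x powr (p - 1) * w j x) \<le> B * (indicator ?K x + u x powr p)" for j
    proof (intro AE_I2)
      fix x
      show "norm (u x powr (p - 1) * w j x) \<le> B * (indicator ?K x + u x powr p)"
      proof (cases "x \<in> ?K")
        case True
        have "u x powr (p - 1) * \<bar>w j x\<bar> \<le> (1 + u x powr p) * B"
          by (intro mult_mono u_powr_pred_le B) (auto intro: add_nonneg_nonneg)
        then show ?thesis using True by (simp add: abs_mult mult.commute)
      next
        case False
        then show ?thesis using B(1) w0[OF \<phi>0[OF False]] by simp
      qed
    qed
  qed measurable
  then have "(\<lambda>j. \<mu> * (\<integral>x. u x powr (p - 1) * w j x \<partial>lborel))
      \<longlonglongrightarrow> \<mu> * (\<integral>x. u x powr (p - 1) * v x \<partial>lborel)"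
    by (intro tendsto_intros)
  with lim1 show "(\<integral>z. weak_integrand q p u v z \<partial>?M) = \<mu> * (\<integral>x. u x powr (p - 1) * v x \<partial>lborel)"
    by (rule LIMSEQ_unique)
qed

end

section \<open>Comparison of the eigenvalue with Rayleigh quotients of test functions\<close>

lemma test_function_powr_integrable:
  assumes \<phi>: "\<phi> \<in> test_functions \<Omega>" and p: "0 \<le> p"
  shows "integrable lborel (\<lambda>x. \<bar>\<phi> x\<bar> powr p)"
proof -
  let ?K = "closure {x. \<phi> x \<noteq> 0}"
  have [measurable]: "\<phi> \<in> borel_measurable borel" using \<phi> by (rule test_functions_measurable)
  obtain M where M: "0 \<le> M" "\<And>x. \<bar>\<phi> x\<bar> \<le> M" using test_functions_bounded[OF \<phi>] by blast
  have int: "integrable lborel (\<lambda>x. M powr p * indicator ?K x)"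
    using \<phi> emeasure_compact_finite[of ?K]
    by (intro integrable_mult_right integrable_real_indicator) (auto simp: test_functions_def)
  have bound: "norm (\<bar>\<phi> x\<bar> powr p) \<le> norm (M powr p * indicator ?K x)" for x
    using M p closure_subset[of "{x. \<phi> x \<noteq> 0}"]
    by (cases "\<phi> x = 0") (auto simp: indicator_def intro!: powr_mono2)
  show ?thesis
    by (rule Bochner_Integration.integrable_bound[OF int _ AE_I2[OF bound]]) measurable
qed

text \<open>A continuous function that is zero almost everywhere is zero, because a nonempty open
  set is not negligible.\<close>

lemma Lp_energy_test_function:
  assumes \<phi>: "\<phi> \<in> test_functions \<Omega>" and nz: "\<phi> \<noteq> (\<lambda>x. 0)" and p: "0 \<le> p"
  shows "Lp_energy UNIV p \<phi> \<noteq> 0" and "Lp_energy UNIV p \<phi> \<noteq> top"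
proof -
  note int = test_function_powr_integrable[OF \<phi> p]
  have [measurable]: "\<phi> \<in> borel_measurable borel" using \<phi> by (rule test_functions_measurable)
  show "Lp_energy UNIV p \<phi> \<noteq> top"
    using int by (simp add: Lp_energy_def nn_integral_eq_integral)
  show "Lp_energy UNIV p \<phi> \<noteq> 0"
  proof
    assume "Lp_energy UNIV p \<phi> = 0"
    then have ae: "AE x in lborel. \<phi> x = 0"
      by (simp add: Lp_energy_def nn_integral_0_iff_AE)
    have "open (\<phi> -` (- {0}))"
      using test_functions_continuous[OF \<phi>] by (intro open_vimage) auto
    moreover have "\<phi> -` (- {0}) = {x. \<not> \<phi> x = 0}" by auto
    ultimately have op: "open {x. \<not> \<phi> x = 0}" by simp
    have "{x. \<not> \<phi> x = 0} \<in> null_sets lborel"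
      using ae by (subst (asm) AE_iff_null_sets[symmetric, of "{x. \<not> \<phi> x = 0}", simplified]) auto
    then have "negligible {x. \<not> \<phi> x = 0}"
      by (simp add: negligible_iff_null_sets null_sets_completionI)
    with op have "{x. \<not> \<phi> x = 0} = {}" using open_not_negligible by blast
    with nz show False by auto
  qed
qed

context nonneg_eigenfunction
begin

lemma weak_integrand_picone_le:
  assumes "0 < \<epsilon>"
  shows "weak_integrand q p u (\<lambda>x. \<bar>f x\<bar> powr p * (u x + \<epsilon>) powr (1 - p)) z
    \<le> diff_quot q p (\<lambda>x. \<bar>f x\<bar>) z"
proof -
  have "0 < u x + \<epsilon>" for x using u_nonneg[of x] assms by linarith
  from discrete_picone[OF this this, of "\<bar>f (snd z)\<bar>" "\<bar>f (fst z)\<bar>" p "snd z" "fst z"]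
  show ?thesis
    using p_ge_2 unfolding weak_integrand_def diff_quot_def
    by (intro mult_right_mono kernel_nonneg) simp
qed

text \<open>At \<open>u x = 0 < u y\<close> the defect in Picone's inequality blows up as \<open>\<epsilon> \<rightarrow> 0\<close>, unless
  \<open>f x = 0\<close>; this replaces the strong minimum principle.\<close>

lemma picone_defect_at_top:
  assumes f: "f x \<noteq> 0" and u: "u x = 0" "u y \<noteq> 0"
  shows "filterlim (\<lambda>k. diff_quot q p (\<lambda>x. \<bar>f x\<bar>) (x, y) - weak_integrand q p u
    (\<lambda>x. \<bar>f x\<bar> powr p * (u x + inverse (real (Suc k))) powr (1 - p)) (x, y)) at_top sequentially"
proof -
  let ?e = "\<lambda>k. inverse (real (Suc k))"
  \<comment> \<open>\<open>c1\<close> is the coefficient of the divergent term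
    \<open>?e k powr (1 - p)\<close>, and \<open>c0\<close> bounds the contribution of
    \<open>f y\<close>.\<close>
  define c0 where "c0 = u y powr (p - 1) * (\<bar>f y\<bar> powr p * u y powr (1 - p)) * kernel q (x, y)"
  define c1 where "c1 = u y powr (p - 1) * \<bar>f x\<bar> powr p * kernel q (x, y)"
  have uy: "0 < u y" using u(2) u_nonneg[of y] by simp
  \<comment> \<open>On the diagonal the kernel has the value 0, so \<open>c1\<close> is positive
    only for distinct points.\<close>
  have "x \<noteq> y" using u by auto
  then have "0 < c1" using f uy by (simp add: c1_def kernel_def)
  have lower: "- c0 + c1 * real (Suc k) \<le> diff_quot q p (\<lambda>x. \<bar>f x\<bar>) (x, y) - weak_integrand q p u
    (\<lambda>x. \<bar>f x\<bar> powr p * (u x + ?e k) powr (1 - p)) (x, y)" for k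
  proof -
    have "weak_integrand q p u (\<lambda>x. \<bar>f x\<bar> powr p * (u x + ?e k) powr (1 - p)) (x, y)
        = u y powr (p - 1) * (\<bar>f y\<bar> powr p * (u y + ?e k) powr (1 - p)
          - \<bar>f x\<bar> powr p * ?e k powr (1 - p)) * kernel q (x, y)"
      using abs_powr_mult_self[OF u_nonneg, of y p] u(1) by (simp add: weak_integrand_def)
    also have "\<dots> = u y powr (p - 1) * (\<bar>f y\<bar> powr p * (u y + ?e k) powr (1 - p)) * kernel q (x, y)
        - c1 * ?e k powr (1 - p)"
      by (simp add: c1_def algebra_simps)
    also have "\<dots> \<le> c0 - c1 * ?e k powr (1 - p)"
      unfolding c0_def using uy p_ge_2
      by (intro diff_right_mono mult_right_mono mult_left_mono powr_mono2' kernel_nonneg) auto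
    also have "?e k powr (1 - p) = real (Suc k) powr (p - 1)"
      using inverse_powr[of "real (Suc k)" "1 - p"] powr_minus[of "real (Suc k)" "1 - p"] by simp
    finally have "weak_integrand q p u (\<lambda>x. \<bar>f x\<bar> powr p * (u x + ?e k) powr (1 - p)) (x, y)
        \<le> c0 - c1 * real (Suc k) powr (p - 1)" .
    \<comment> \<open>Since \<open>p - 1\<close> is at least 1, linear growth is a valid lower
      bound.\<close>
    moreover have "c1 * real (Suc k) \<le> c1 * real (Suc k) powr (p - 1)"
      using \<open>0 < c1\<close> p_ge_2 powr_mono[of 1 "p - 1" "real (Suc k)"]
      by (intro mult_left_mono) auto
    ultimately show ?thesis
      using diff_quot_nonneg[of q p "\<lambda>x. \<bar>f x\<bar>" "(x, y)"] by linarith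
  qed
  have "filterlim (\<lambda>k. real (Suc k)) at_top sequentially"
    by (rule filterlim_compose[OF filterlim_real_sequentially filterlim_Suc])
  then have "filterlim (\<lambda>k. c1 * real (Suc k)) at_top sequentially"
    by (rule filterlim_tendsto_pos_mult_at_top[OF tendsto_const \<open>0 < c1\<close>])
  then have "filterlim (\<lambda>k. - c0 + c1 * real (Suc k)) at_top sequentially"
    by (rule filterlim_tendsto_add_at_top[OF tendsto_const])
  then show ?thesis
    by (rule filterlim_at_top_mono) (use lower in auto)
qed

lemma picone_bound:
  assumes \<phi>: "\<phi> \<in> test_functions \<Omega>"
  shows "ennreal \<mu> * Lp_energy UNIV p \<phi> \<le> gagliardo_energy UNIV q p \<phi>"
proof (cases "gagliardo_energy UNIV q p \<phi> < \<infinity> \<and> 0 \<le> \<mu>")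
  case False
  \<comment> \<open>An infinite right side is trivial, and for negative \<open>\<mu>\<close> the
    left side is 0 by truncation.\<close>
  then show ?thesis by (auto simp: ennreal_neg less_top[symmetric])
next
  case True
  then have fin: "gagliardo_energy UNIV q p \<phi> < \<infinity>" and \<mu>: "0 \<le> \<mu>" by auto
  let ?M = "lborel \<Otimes>\<^sub>M (lborel :: 'a measure)"
  define \<epsilon> where "\<epsilon> k = inverse (real (Suc k))" for k
  have \<epsilon>: "0 < \<epsilon> k" "\<epsilon> \<longlonglongrightarrow> 0" for k
    unfolding \<epsilon>_def using LIMSEQ_inverse_real_of_nat by auto
  define v where "v k x = \<bar>\<phi> x\<bar> powr p * (u x + \<epsilon> k) powr (1 - p)" for k x
  have [measurable]: "\<phi> \<in> borel_measurable borel" using \<phi> by (rule test_functions_measurable)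
  have [measurable]: "v k \<in> borel_measurable borel" for k unfolding v_def by measurable
  note picone = weak_equation_picone[OF \<phi> fin \<epsilon>(1), folded v_def]
  have \<phi>_int: "integrable ?M (diff_quot q p \<phi>)"
    using fin by (intro integrableI_nonneg) (auto simp: gagliardo_energy_UNIV diff_quot_nonneg)
  have abs_le: "diff_quot q p (\<lambda>x. \<bar>\<phi> x\<bar>) z \<le> diff_quot q p \<phi> z" for z
    unfolding diff_quot_def using p_ge_2
    by (intro mult_right_mono powr_mono2 kernel_nonneg) auto
  \<comment> \<open>The defect in Picone's inequality. That inequality concerns nonnegative numbers,
    so the comparison is with \<open>\<bar>\<phi>\<bar>\<close>, whose energy density is at most
    that of \<open>\<phi>\<close>.\<close>
  define F where "F k z = diff_quot q p (\<lambda>x. \<bar>\<phi> x\<bar>) z - weak_integrand q p u (v k) z" for k z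
  have F_nonneg: "0 \<le> F k z" for k z
    using weak_integrand_picone_le[OF \<epsilon>(1), where f = \<phi> and z = z]
    by (simp add: F_def v_def[abs_def])
  have abs_int: "integrable ?M (diff_quot q p (\<lambda>x. \<bar>\<phi> x\<bar>))"
    by (rule Bochner_Integration.integrable_bound[OF \<phi>_int])
      (auto simp: diff_quot_nonneg intro: abs_le)
  define E where "E = (\<integral>z. diff_quot q p \<phi> z \<partial>?M)"
  define I where "I k = (\<integral>x. u x powr (p - 1) * v k x \<partial>lborel)" for k
  have F_int: "integrable ?M (F k)" for k
    unfolding F_def[abs_def] by (intro Bochner_Integration.integrable_diff abs_int picone)
  have F_le: "(\<integral>z. F k z \<partial>?M) \<le> E - \<mu> * I k" for k
    unfolding F_def E_def I_def using abs_int picone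
    by (simp add: integral_mono[OF abs_int \<phi>_int abs_le])
  have I_nonneg: "0 \<le> I k" for k
    unfolding I_def v_def by (intro integral_nonneg_AE) auto
  have \<mu>I_le: "\<mu> * I k \<le> E" for k
  proof -
    have "0 \<le> (\<integral>z. F k z \<partial>?M)" by (intro integral_nonneg_AE AE_I2 F_nonneg)
    with F_le[of k] show ?thesis by linarith
  qed

  have [measurable]: "F k \<in> borel_measurable ?M" for k using F_int by auto
  have "(\<integral>\<^sup>+z. liminf (\<lambda>k. ennreal (F k z)) \<partial>?M) \<le> liminf (\<lambda>k. \<integral>\<^sup>+z. ennreal (F k z) \<partial>?M)"
    by (rule nn_integral_liminf) measurable
  also have "\<dots> \<le> liminf (\<lambda>k. ennreal E)"
  proof (intro Liminf_mono always_eventually allI)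
    fix k
    have "(\<integral>\<^sup>+z. ennreal (F k z) \<partial>?M) = ennreal (\<integral>z. F k z \<partial>?M)"
      using F_int F_nonneg by (intro nn_integral_eq_integral) auto
    \<comment> \<open>The bound is uniform in \<open>k\<close> because \<open>\<mu> * I k\<close> is
      nonnegative.\<close>
    also have "\<dots> \<le> ennreal E"
      using F_le[of k] mult_nonneg_nonneg[OF \<mu> I_nonneg[of k]] by (intro ennreal_leI) simp
    finally show "(\<integral>\<^sup>+z. ennreal (F k z) \<partial>?M) \<le> ennreal E" .
  qed
  also have "\<dots> < \<infinity>" by (simp add: Liminf_const)
  finally have "AE z in ?M. liminf (\<lambda>k. ennreal (F k z)) \<noteq> \<infinity>"
    by (intro nn_integral_PInf_AE) auto
  then have null: "AE z in ?M. \<not> (\<phi> (fst z) \<noteq> 0 \<and> u (fst z) = 0 \<and> u (snd z) \<noteq> 0)"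
  proof eventually_elim
    case (elim z)
    show ?case
    proof
      assume "\<phi> (fst z) \<noteq> 0 \<and> u (fst z) = 0 \<and> u (snd z) \<noteq> 0"
      then have "filterlim (\<lambda>k. F k z) at_top sequentially"
        using picone_defect_at_top[of \<phi> "fst z" "snd z"] by (simp add: F_def v_def[abs_def] \<epsilon>_def)
      then have "(\<lambda>k. ennreal (F k z)) \<longlonglongrightarrow> top"
        by (simp add: ennreal_tendsto_top_eq_at_top)
      then have "liminf (\<lambda>k. ennreal (F k z)) = top"
        by (intro lim_imp_Liminf) auto
      with elim show False by simp
    qed
  qed
  \<comment> \<open>The defect blows up on \<open>A \<times> B\<close>, so this product is a null
    set. As \<open>u\<close> is not zero almost everywhere, \<open>B\<close> has positive measure
    and \<open>A\<close> must be null.\<close>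
  define A where "A = {x. \<phi> x \<noteq> 0 \<and> u x = 0}"
  define B where "B = {x. u x \<noteq> 0}"
  have [measurable]: "A \<in> sets borel" "B \<in> sets borel" unfolding A_def B_def by measurable
  have "AE z in ?M. z \<notin> A \<times> B"
    using null by eventually_elim (auto simp: A_def B_def)
  then have "emeasure ?M (A \<times> B) = 0"
    by (subst (asm) AE_iff_null_sets[symmetric]) (auto simp: null_sets_def)
  then have "emeasure lborel A * emeasure lborel B = 0"
    by (simp add: lborel.emeasure_pair_measure_Times)
  moreover have "emeasure lborel B \<noteq> 0"
  proof
    assume "emeasure lborel B = 0"
    then have "AE x in lborel. x \<notin> B" by (intro AE_not_in) (auto simp: null_sets_def)
    with u_nonzero show False by (simp add: B_def)
  qed
  ultimately have "emeasure lborel A = 0" by simp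
  then have "AE x in lborel. x \<notin> A" by (intro AE_not_in) (auto simp: null_sets_def)
  then have pos: "AE x in lborel. \<phi> x \<noteq> 0 \<longrightarrow> u x \<noteq> 0"
    by eventually_elim (auto simp: A_def)

  have \<phi>_Lp: "integrable lborel (\<lambda>x. \<bar>\<phi> x\<bar> powr p)"
    using p_ge_2 by (intro test_function_powr_integrable[OF \<phi>]) simp
  have "I \<longlonglongrightarrow> (\<integral>x. \<bar>\<phi> x\<bar> powr p \<partial>lborel)"
    unfolding I_def
  proof (rule integral_dominated_convergence[OF _ _ \<phi>_Lp])
    \<comment> \<open>In this form the quotient \<open>u x / (u x + \<epsilon> k)\<close> lies
      between 0 and 1 and tends to 1 where \<open>u x\<close> is nonzero. This gives both the
      majorant and the limit.\<close>
    have v_eq: "u x powr (p - 1) * v k x = \<bar>\<phi> x\<bar> powr p * (u x / (u x + \<epsilon> k)) powr (p - 1)" for k x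
    proof -
      have "(u x + \<epsilon> k) powr (1 - p) = 1 / (u x + \<epsilon> k) powr (p - 1)"
        using powr_minus_divide[of "u x + \<epsilon> k" "p - 1"] by simp
      then show ?thesis by (simp add: v_def powr_divide)
    qed
    show "AE x in lborel. (\<lambda>k. u x powr (p - 1) * v k x) \<longlonglongrightarrow> \<bar>\<phi> x\<bar> powr p"
      using pos
    proof eventually_elim
      case (elim x)
      show ?case
      proof (cases "\<phi> x = 0")
        case True
        then show ?thesis by (simp add: v_def)
      next
        case False
        then have ux: "u x \<noteq> 0" using elim by simp
        have "(\<lambda>k. \<bar>\<phi> x\<bar> powr p * (u x / (u x + \<epsilon> k)) powr (p - 1))
            \<longlonglongrightarrow> \<bar>\<phi> x\<bar> powr p * (u x / (u x + 0)) powr (p - 1)"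
          using ux by (intro tendsto_intros \<epsilon>(2)) auto
        then show ?thesis using ux by (simp add: v_eq)
      qed
    qed
    show "AE x in lborel. norm (u x powr (p - 1) * v k x) \<le> \<bar>\<phi> x\<bar> powr p" for k
    proof (intro AE_I2)
      fix x
      have "(u x / (u x + \<epsilon> k)) powr (p - 1) \<le> 1"
        using u_nonneg[of x] \<epsilon>(1)[of k] p_ge_2 by (intro powr_le1) (auto simp: divide_le_eq_1)
      then show "norm (u x powr (p - 1) * v k x) \<le> \<bar>\<phi> x\<bar> powr p"
        unfolding v_eq by (simp add: abs_mult mult_left_le)
    qed
  qed measurable
  then have "(\<lambda>k. \<mu> * I k) \<longlonglongrightarrow> \<mu> * (\<integral>x. \<bar>\<phi> x\<bar> powr p \<partial>lborel)"
    by (intro tendsto_intros)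
  then have "\<mu> * (\<integral>x. \<bar>\<phi> x\<bar> powr p \<partial>lborel) \<le> E"
    by (rule LIMSEQ_le_const2) (use \<mu>I_le in auto)
  then have "ennreal (\<mu> * (\<integral>x. \<bar>\<phi> x\<bar> powr p \<partial>lborel)) \<le> ennreal E" by (rule ennreal_leI)
  moreover have "Lp_energy UNIV p \<phi> = ennreal (\<integral>x. \<bar>\<phi> x\<bar> powr p \<partial>lborel)"
    using \<phi>_Lp by (simp add: Lp_energy_def nn_integral_eq_integral)
  moreover have "gagliardo_energy UNIV q p \<phi> = ennreal E"
    using \<phi>_int by (simp add: gagliardo_energy_UNIV E_def nn_integral_eq_integral diff_quot_nonneg)
  ultimately show ?thesis using \<mu> by (simp add: ennreal_mult')
qed

end

section \<open>Change of representative and conclusion\<close>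

lemma gagliardo_energy_cong_AE:
  assumes "AE x in lborel. u x = v x"
  shows "gagliardo_energy A q p u = gagliardo_energy A q p v"
  unfolding gagliardo_energy_eq using AE_lborel_pair[OF assms]
  by (intro nn_integral_cong_AE, eventually_elim) (simp add: diff_quot_def)

lemma Lp_energy_cong_AE:
  assumes "AE x in lborel. u x = v x"
  shows "Lp_energy A p u = Lp_energy A p v"
  unfolding Lp_energy_def using assms
  by (intro nn_integral_cong_AE, eventually_elim) simp

theorem theorem16:
  fixes \<Omega> :: "'a::euclidean_space set"
    and \<alpha> p s \<mu> :: real
    and u :: "'a \<Rightarrow> real"
  assumes "open \<Omega>" and "connected \<Omega>" and "\<Omega> \<noteq> {}" and "bounded \<Omega>"
    and "p \<ge> 2"
    and "2 * real DIM('a) < \<alpha> * p" and "\<alpha> * p < real DIM('a) + p"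
    and "s = \<alpha> - real DIM('a) / p"
    and "u \<in> frac_sobolev0 s p \<Omega>"
    and "AE x in lborel. 0 \<le> u x"
    and "eigenfunction \<alpha> p \<Omega> \<mu> u"
  shows "rayleigh_quotient \<alpha> p u = lambda1 \<alpha> p \<Omega>"
proof -
  define q where "q = \<alpha> * p"
  \<comment> \<open>This changes \<open>u\<close> on a null set only, makes the sign condition hold
    at every point and keeps the value 0 outside \<open>\<Omega>\<close>.\<close>
  define u' where "u' x = max 0 (u x)" for x
  have exponent: "real DIM('a) + s * p = q"
    using assms(5) unfolding q_def assms(8) by (simp add: left_diff_distrib)
  have u_eq: "AE x in lborel. u x = u' x"
    using assms(10) by eventually_elim (simp add: u'_def)
  have [measurable]: "u \<in> borel_measurable borel"
    using assms(9) by (simp add: frac_sobolev0_def)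
  then have [measurable]: "u' \<in> borel_measurable borel"
    unfolding u'_def by measurable
  have norm_eq: "frac_norm_pow s p \<Omega> f = gagliardo_energy \<Omega> q p f + Lp_energy \<Omega> p f"
    for f :: "'a \<Rightarrow> real"
    by (simp add: frac_norm_pow_def exponent)
  have frac_fin: "frac_norm_pow s p \<Omega> u < \<infinity>"
    using assms(9) by (simp add: frac_sobolev0_def)
  interpret nonneg_eigenfunction \<Omega> q p \<mu> u'
  proof
    show "open \<Omega>" "2 \<le> p" "u' \<in> borel_measurable borel" by fact+
    show "real DIM('a) < q" using assms(6) by (simp add: q_def)
    show "0 \<le> u' x" for x by (simp add: u'_def)
    show "u' x = 0" if "x \<notin> \<Omega>" for x
      using assms(9) that by (simp add: u'_def frac_sobolev0_def)
    show "gagliardo_energy \<Omega> q p u' < \<infinity>" "Lp_energy \<Omega> p u' < \<infinity>"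
      using frac_fin gagliardo_energy_cong_AE[OF u_eq] Lp_energy_cong_AE[OF u_eq]
      by (auto simp: norm_eq)
    show "\<not> (AE x in lborel. u' x = 0)"
    proof
      assume "AE x in lborel. u' x = 0"
      with u_eq have "AE x in lborel. u x = 0" by eventually_elim simp
      with assms(11) show False by (simp add: eigenfunction_def)
    qed
    show "\<exists>\<phi>\<in>test_functions \<Omega>.
      gagliardo_energy \<Omega> q p (\<lambda>x. \<phi> x - u' x) + Lp_energy \<Omega> p (\<lambda>x. \<phi> x - u' x) < \<epsilon>"
      if \<epsilon>: "0 < \<epsilon>" for \<epsilon>
    proof -
      obtain \<phi> where \<phi>: "\<phi> \<in> test_functions \<Omega>" "frac_norm_pow s p \<Omega> (\<lambda>x. \<phi> x - u x) < \<epsilon>"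
        using assms(9) \<epsilon> unfolding frac_sobolev0_def by blast
      have "AE x in lborel. \<phi> x - u x = \<phi> x - u' x" using u_eq by eventually_elim simp
      with \<phi> show ?thesis
        by (auto simp: norm_eq gagliardo_energy_cong_AE Lp_energy_cong_AE intro!: bexI[of _ \<phi>])
    qed
    show "(\<integral>z. weak_integrand q p u' \<phi> z \<partial>(lborel \<Otimes>\<^sub>M lborel)) = \<mu> * (\<integral>x. u' x powr (p - 1) * \<phi> x \<partial>lborel)"
      if \<phi>: "\<phi> \<in> test_functions \<Omega>" for \<phi>
    proof -
      have [measurable]: "\<phi> \<in> borel_measurable borel" using \<phi> by (rule test_functions_measurable)
      have "(\<integral>z. weak_integrand q p u' \<phi> z \<partial>(lborel \<Otimes>\<^sub>M lborel))
          = (\<integral>z. weak_integrand q p u \<phi> z \<partial>(lborel \<Otimes>\<^sub>M lborel))"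
      proof (rule integral_cong_AE)
        show "AE z in lborel \<Otimes>\<^sub>M lborel. weak_integrand q p u' \<phi> z = weak_integrand q p u \<phi> z"
          using AE_lborel_pair[OF u_eq] by eventually_elim (simp add: weak_integrand_def)
      qed measurable
      also have "\<dots> = \<mu> * (\<integral>x. \<bar>u x\<bar> powr (p - 2) * u x * \<phi> x \<partial>lborel)"
        using assms(11) \<phi> by (simp add: eigenfunction_def weak_integrand_eq q_def)
      also have "(\<integral>x. \<bar>u x\<bar> powr (p - 2) * u x * \<phi> x \<partial>lborel)
          = (\<integral>x. u' x powr (p - 1) * \<phi> x \<partial>lborel)"
      proof (rule integral_cong_AE)
        show "AE x in lborel. \<bar>u x\<bar> powr (p - 2) * u x * \<phi> x = u' x powr (p - 1) * \<phi> x"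
          using u_eq
        proof eventually_elim
          case (elim x)
          have "0 \<le> u' x" by (simp add: u'_def)
          then show ?case by (simp only: elim abs_powr_mult_self)
        qed
      qed measurable
      finally show ?thesis .
    qed
  qed
  let ?E = "gagliardo_energy UNIV q p" and ?L = "Lp_energy UNIV p"
  have L: "?L u' \<noteq> 0" "?L u' \<noteq> top"
    using integral_u_powr_pos by (auto simp: Lp_energy_u)
  \<comment> \<open>Bounds on quotients and on products are interchangeable in
    \<open>ennreal\<close> once the denominator is known to be finite and nonzero.\<close>
  have quotient_le: "\<Lambda> \<le> e / l" if "\<Lambda> * l \<le> e" "l \<noteq> 0" "l \<noteq> top" for \<Lambda> e l :: ennreal
    using divide_right_mono_ennreal[OF that(1), of l] that by (simp add: ennreal_mult_divide_eq)
  have le_quotient: "\<Lambda> * l \<le> e" if "\<Lambda> \<le> e / l" "l \<noteq> 0" "l \<noteq> top" for \<Lambda> e l :: ennreal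
  proof -
    have "\<Lambda> * l \<le> e / l * l" using that by (intro mult_right_mono) auto
    also have "\<dots> = e" using that by (simp add: ennreal_divide_times ennreal_divide_self top.not_eq_extremum)
    finally show ?thesis .
  qed
  have p0: "0 \<le> p" using assms(5) by simp
  have \<mu>_le: "ennreal \<mu> \<le> lambda1 \<alpha> p \<Omega>"
    unfolding lambda1_def
  proof (rule INF_greatest)
    fix \<phi> assume "\<phi> \<in> test_functions \<Omega> - {\<lambda>x. 0}"
    then have \<phi>: "\<phi> \<in> test_functions \<Omega>" "\<phi> \<noteq> (\<lambda>x. 0)" by auto
    show "ennreal \<mu> \<le> rayleigh_quotient \<alpha> p \<phi>"
      unfolding rayleigh_quotient_def q_def[symmetric]
      by (intro quotient_le picone_bound[OF \<phi>(1)] Lp_energy_test_function[OF \<phi> p0])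
  qed
  have "lambda1 \<alpha> p \<Omega> * ?L u' \<le> ?E u'"
  proof (rule rayleigh_lower_bound)
    fix \<phi> assume \<phi>: "\<phi> \<in> test_functions \<Omega>"
    show "lambda1 \<alpha> p \<Omega> * ?L \<phi> \<le> ?E \<phi>"
    proof (cases "\<phi> = (\<lambda>x. 0)")
      case True
      then show ?thesis by (simp add: Lp_energy_def)
    next
      case False
      have "lambda1 \<alpha> p \<Omega> \<le> ?E \<phi> / ?L \<phi>"
        using \<phi> False unfolding lambda1_def rayleigh_quotient_def q_def by (intro INF_lower) auto
      then show ?thesis by (intro le_quotient Lp_energy_test_function[OF \<phi> False p0])
    qed
  qed
  then have ge: "lambda1 \<alpha> p \<Omega> \<le> ?E u' / ?L u'"
    by (intro quotient_le L)
  have "?E u' \<le> ennreal \<mu> * ?L u'"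
    using energy_le_eigenvalue integral_u_powr_pos by (simp add: Lp_energy_u ennreal_mult'')
  then have "?E u' / ?L u' \<le> ennreal \<mu> * ?L u' / ?L u'" by (rule divide_right_mono_ennreal)
  then have "?E u' / ?L u' \<le> ennreal \<mu>" using L by (simp add: ennreal_mult_divide_eq)
  \<comment> \<open>The cycle from \<open>lambda1\<close> to the quotient of \<open>u'\<close>, to
    \<open>\<mu>\<close> and back to \<open>lambda1\<close> closes, so all three agree.\<close>
  with \<mu>_le ge have "?E u' / ?L u' = lambda1 \<alpha> p \<Omega>" by simp
  then show ?thesis
    unfolding rayleigh_quotient_def q_def
    using gagliardo_energy_cong_AE[OF u_eq, of UNIV "\<alpha> * p" p] Lp_energy_cong_AE[OF u_eq, of UNIV p]
    by simp
qed

end
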